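(* Assume $\psi$ is a finite Blaschke product of order $2$. Then the multiplication operator $M_\psi$, $M_\psi f=\psi f$, is reducible on $S^2(\mathbb{D})$ if and only if $\psi$ is equivalent to $z^2$.
   Context: $\mathbb{D}$ is the open unit disk and $H(\mathbb{D})$ the space of analytic functions on $\mathbb{D}$; for $f\in H(\mathbb{D})$ write $f(z)=\sum_{n\ge0}f_nz^n$. $S^2(\mathbb{D})$ is the Hilbert space $\{f\in H(\mathbb{D}):\|f\|_{S^2}^2=|f(0)|^2+\|f'\|_{H^2}^2=|f_0|^2+\sum_{n\ge1}n^2|f_n|^2<\infty\}$. A closed subspace $\mathcal{M}$ is reducing for a bounded operator $T$ if $T\mathcal{M}\subseteq\mathcal{M}$ and $T\mathcal{M}^\perp\subseteq\mathcal{M}^\perp$; $T$ is reducible if it has a reducing subspace other than $\{0\}$ and the whole space. The order of a finite Blaschke product is its number of zeros in $\mathbb{D}$ counted with multiplicity. For $\alpha\in\mathbb{D}$, $\varphi_\alpha(z)=\frac{\alpha-z}{1-\overline{\alpha}z}$. Two finite Blaschke products $\psi$ and $\phi$ are called equivalent if there exist $a\in\mathbb{C}$ with $|a|=1$ and $\alpha\in\mathbb{D}$ such that $\phi(z)=a\varphi_\alpha(\psi(z))$. *)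

theory Defs
  imports "HOL-Complex_Analysis.Complex_Analysis"
begin

definition taylor_coeff :: "(complex \<Rightarrow> complex) \<Rightarrow> nat \<Rightarrow> complex" where
  "taylor_coeff f n = (deriv ^^ n) f 0 / fact n"

text \<open>
  Elements of the space are total functions on the complex plane; as only their restrictions
  to the unit disk matter, each is represented by the function that vanishes off the disk. This
  makes equality of elements equality of functions.
\<close>

definition S2 :: "(complex \<Rightarrow> complex) set" where
  "S2 = {f. f holomorphic_on ball 0 1 \<and> (\<forall>z. z \<notin> ball 0 1 \<longrightarrow> f z = 0) \<and>
            summable (\<lambda>n. (real n)\<^sup>2 * (cmod (taylor_coeff f n))\<^sup>2)}"

text \<open>
  The series below start at \<open>n = 0\<close>, where the summand vanishes, so they are the sums over
  \<open>n \<ge> 1\<close>. They are used only for elements of the space, where they converge.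
\<close>

definition S2_norm :: "(complex \<Rightarrow> complex) \<Rightarrow> real" where
  "S2_norm f = sqrt ((cmod (taylor_coeff f 0))\<^sup>2 +
                     (\<Sum>n. (real n)\<^sup>2 * (cmod (taylor_coeff f n))\<^sup>2))"

definition S2_inner :: "(complex \<Rightarrow> complex) \<Rightarrow> (complex \<Rightarrow> complex) \<Rightarrow> complex" where
  "S2_inner f g = taylor_coeff f 0 * cnj (taylor_coeff g 0) +
                  (\<Sum>n. (of_nat n)\<^sup>2 * taylor_coeff f n * cnj (taylor_coeff g n))"

definition S2_closed_subspace :: "(complex \<Rightarrow> complex) set \<Rightarrow> bool" where
  "S2_closed_subspace M \<longleftrightarrow>
     M \<subseteq> S2 \<and> (\<lambda>z. 0) \<in> M \<and>
     (\<forall>f\<in>M. \<forall>g\<in>M. (\<lambda>z. f z + g z) \<in> M) \<and>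
     (\<forall>c. \<forall>f\<in>M. (\<lambda>z. c * f z) \<in> M) \<and>
     (\<forall>F. \<forall>f\<in>S2. (\<forall>k::nat. F k \<in> M) \<and> (\<lambda>k. S2_norm (\<lambda>z. F k z - f z)) \<longlonglongrightarrow> 0
        \<longrightarrow> f \<in> M)"

definition S2_orth :: "(complex \<Rightarrow> complex) set \<Rightarrow> (complex \<Rightarrow> complex) set" where
  "S2_orth M = {g \<in> S2. \<forall>f\<in>M. S2_inner f g = 0}"

definition S2_reducing ::
    "((complex \<Rightarrow> complex) \<Rightarrow> complex \<Rightarrow> complex) \<Rightarrow> (complex \<Rightarrow> complex) set \<Rightarrow> bool" where
  "S2_reducing T M \<longleftrightarrow> S2_closed_subspace M \<and> T ` M \<subseteq> M \<and> T ` S2_orth M \<subseteq> S2_orth M"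

definition S2_reducible :: "((complex \<Rightarrow> complex) \<Rightarrow> complex \<Rightarrow> complex) \<Rightarrow> bool" where
  "S2_reducible T \<longleftrightarrow> (\<exists>M. S2_reducing T M \<and> M \<noteq> {\<lambda>z. 0} \<and> M \<noteq> S2)"

definition mult_op :: "(complex \<Rightarrow> complex) \<Rightarrow> (complex \<Rightarrow> complex) \<Rightarrow> complex \<Rightarrow> complex" where
  "mult_op \<psi> f = (\<lambda>z. \<psi> z * f z)"

definition disk_aut :: "complex \<Rightarrow> complex \<Rightarrow> complex" where
  "disk_aut \<alpha> z = (\<alpha> - z) / (1 - cnj \<alpha> * z)"

text \<open>Only the values on the unit disk are constrained; \<open>\<psi>\<close> is arbitrary elsewhere.\<close>

definition finite_blaschke :: "(complex \<Rightarrow> complex) \<Rightarrow> bool" where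
  "finite_blaschke \<psi> \<longleftrightarrow>
     (\<exists>c (n::nat) a. cmod c = 1 \<and> (\<forall>k<n. a k \<in> ball 0 1) \<and>
        (\<forall>z\<in>ball 0 1. \<psi> z = c * (\<Prod>k<n. disk_aut (a k) z)))"

definition blaschke_order :: "(complex \<Rightarrow> complex) \<Rightarrow> nat" where
  "blaschke_order \<psi> = (\<Sum>z\<in>{z \<in> ball 0 1. \<psi> z = 0}. nat (zorder \<psi> z))"

definition blaschke_equivalent :: "(complex \<Rightarrow> complex) \<Rightarrow> (complex \<Rightarrow> complex) \<Rightarrow> bool" where
  "blaschke_equivalent \<psi> \<phi> \<longleftrightarrow>
     (\<exists>a \<alpha>. cmod a = 1 \<and> \<alpha> \<in> ball 0 1 \<and>
        (\<forall>z\<in>ball 0 1. \<phi> z = a * disk_aut \<alpha> (\<psi> z)))"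

end

theory Submission
  imports Defs
begin

text \<open>
  Let \<open>\<psi> = c \<phi>\<^sub>a \<phi>\<^sub>b\<close> with Taylor series \<open>\<Psi>\<close>.

  If \<open>\<psi>\<close> is equivalent to \<open>z\<^sup>2\<close>, then \<open>\<psi>\<close> is even, and the even functions form a reducing subspace whose
  complement consists of the odd functions (\<open>S2_reducible_even\<close>).

  Conversely, let \<open>f\<close> lie in a reducing subspace and \<open>g\<close> in its complement. Then
  \<open>\<langle>\<psi>\<^sup>n f, \<psi>\<^sup>n g\<rangle> = 0\<close> for all \<open>n\<close>. Multiplication by \<open>\<psi>\<close> is isometric on the Hardy space, so the left-hand
  side is a quadratic polynomial in \<open>n\<close> plus \<open>\<bar>\<psi> 0\<bar>\<^sup>2\<^sup>n f(0) cnj (g(0))\<close>, and every coefficient must vanish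
  (\<open>S2_fps_inner_power_orthogonal\<close>). In particular \<open>f(0) cnj (g(0)) = 0\<close>, which means that one of the two
  subspaces contains the constant \<open>1\<close> and hence all powers of \<open>\<psi>\<close>, while the other one contains some \<open>g \<noteq> 0\<close>
  (\<open>S2_reducible_imp_orthogonal_to_powers\<close>). The remaining coefficients then say that \<open>\<psi> g'\<close> and
  \<open>\<psi> \<psi>' g\<close> are orthogonal in the Hardy space to all \<open>\<psi>' \<psi>\<^sup>k\<close>.

  Such an orthogonality is a statement about traces over the fibres of \<open>\<psi>\<close>. Let \<open>\<tau>\<close> be the automorphism of
  the disk that exchanges the two points of each fibre. If \<open>\<psi> u\<close> is orthogonal to all \<open>\<psi>' \<psi>\<^sup>k\<close>, then
  \<open>z u(z) + \<tau>(z) u(\<tau>(z)) = 0\<close> wherever \<open>\<psi>(z) \<noteq> 0\<close>. The reason is that the series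
  \<open>\<Sum>k. (cnj w)\<^sup>k\<^sup>+\<^sup>1 \<psi>' \<psi>\<^sup>k\<close> with \<open>w = \<psi>(z)\<close> is a logarithmic derivative, whose partial fractions are
  Szego kernels at \<open>z\<close>, \<open>\<tau>(z)\<close>, \<open>a\<close> and \<open>b\<close> (\<open>blaschke2_log_deriv\<close>, \<open>blaschke2_trace_eq_zero\<close>).

  For \<open>u = g'\<close> and \<open>u = \<psi>' g\<close> this yields two functional equations for \<open>g\<close>. Eliminating \<open>g'\<close> and
  \<open>g \<circ> \<tau>\<close> gives a differential equation for \<open>\<tau>\<close> alone, which at the origin reads \<open>\<tau>'(0) \<tau>(0) = 0\<close>. So
  \<open>\<tau>(0) = 0\<close> (\<open>swap_point_eq_0\<close>). This forces \<open>b = - a\<close>, and then \<open>\<psi>\<close> is a disk automorphism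
  of \<open>z\<^sup>2\<close> followed by a rotation (\<open>blaschke2_symmetric_equivalent\<close>).
\<close>

\<comment> \<open>\<open>$\<close> denotes coefficients of power series only\<close>
unbundle no vec_syntax

section \<open>The Hardy space of square-summable power series\<close>

text \<open>
  The functions of the Hardy space are represented by their Taylor series. Multiplication and
  differentiation are then algebraic operations, and no boundary values occur.
\<close>
definition H2 :: "complex fps set" where
  "H2 = {F. summable (\<lambda>n. (cmod (F $ n))\<^sup>2)}"

definition H2_norm_sq :: "complex fps \<Rightarrow> real" where
  "H2_norm_sq F = (\<Sum>n. (cmod (F $ n))\<^sup>2)"

definition H2_inner :: "complex fps \<Rightarrow> complex fps \<Rightarrow> complex" where
  "H2_inner F G = (\<Sum>n. F $ n * cnj (G $ n))"

lemma H2_inner_summable: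
  assumes "F \<in> H2" "G \<in> H2"
  shows "summable (\<lambda>n. F $ n * cnj (G $ n))"
proof (rule summable_comparison_test')
  show "summable (\<lambda>n. (cmod (F $ n))\<^sup>2 + (cmod (G $ n))\<^sup>2)"
    using assms unfolding H2_def by (auto intro: summable_add)
  show "norm (F $ n * cnj (G $ n)) \<le> (cmod (F $ n))\<^sup>2 + (cmod (G $ n))\<^sup>2" for n
    using sum_squares_bound[of "cmod (F $ n)" "cmod (G $ n)"]
      mult_nonneg_nonneg[OF norm_ge_zero norm_ge_zero, of "F $ n" "G $ n"]
    unfolding norm_mult complex_mod_cnj by linarith
qed

lemma H2_zero [simp]: "0 \<in> H2"
  by (simp add: H2_def)

lemma H2_one [simp]: "1 \<in> H2"
proof -
  have "summable (\<lambda>n. (cmod ((1::complex fps) $ n))\<^sup>2)"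
    by (rule summable_finite[of "{0}"]) auto
  then show ?thesis by (simp add: H2_def)
qed

lemma H2_const_mult [simp]: "F \<in> H2 \<Longrightarrow> fps_const c * F \<in> H2"
  by (simp add: H2_def norm_mult power_mult_distrib summable_mult)

lemma H2_add [simp]:
  assumes "F \<in> H2" "G \<in> H2"
  shows "F + G \<in> H2"
proof -
  have "summable (\<lambda>n. (cmod ((F + G) $ n))\<^sup>2)"
  proof (rule summable_comparison_test')
    show "summable (\<lambda>n. 2 * ((cmod (F $ n))\<^sup>2 + (cmod (G $ n))\<^sup>2))"
      using assms unfolding H2_def by (auto intro: summable_add summable_mult)
    fix n
    have "(cmod (F $ n + G $ n))\<^sup>2 \<le> (cmod (F $ n) + cmod (G $ n))\<^sup>2"
      by (intro power_mono norm_triangle_ineq) auto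
    also have "\<dots> \<le> 2 * ((cmod (F $ n))\<^sup>2 + (cmod (G $ n))\<^sup>2)"
      using sum_squares_bound[of "cmod (F $ n)" "cmod (G $ n)"] by (simp add: power2_sum)
    finally show "norm ((cmod ((F + G) $ n))\<^sup>2) \<le> 2 * ((cmod (F $ n))\<^sup>2 + (cmod (G $ n))\<^sup>2)"
      by simp
  qed
  then show ?thesis by (simp add: H2_def)
qed

lemma H2_uminus [simp]: "F \<in> H2 \<Longrightarrow> - F \<in> H2"
  by (simp add: H2_def)

lemma H2_diff [simp]: "F \<in> H2 \<Longrightarrow> G \<in> H2 \<Longrightarrow> F - G \<in> H2"
  using H2_add[of F "- G"] by simp

lemma H2_X_mult_iff [simp]: "fps_X * F \<in> H2 \<longleftrightarrow> F \<in> H2"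
proof -
  have "summable (\<lambda>n. (cmod ((fps_X * F) $ n))\<^sup>2) \<longleftrightarrow> summable (\<lambda>n. (cmod ((fps_X * F) $ Suc n))\<^sup>2)"
    by (rule summable_Suc_iff[symmetric])
  then show ?thesis by (simp add: H2_def)
qed

lemma H2_inner_add_left [simp]:
  "F \<in> H2 \<Longrightarrow> F' \<in> H2 \<Longrightarrow> G \<in> H2 \<Longrightarrow> H2_inner (F + F') G = H2_inner F G + H2_inner F' G"
  by (simp add: H2_inner_def distrib_right suminf_add[OF H2_inner_summable H2_inner_summable])

lemma H2_inner_add_right [simp]:
  "F \<in> H2 \<Longrightarrow> G \<in> H2 \<Longrightarrow> G' \<in> H2 \<Longrightarrow> H2_inner F (G + G') = H2_inner F G + H2_inner F G'"
  by (simp add: H2_inner_def distrib_left suminf_add[OF H2_inner_summable H2_inner_summable])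

lemma H2_inner_scale_left [simp]:
  "F \<in> H2 \<Longrightarrow> G \<in> H2 \<Longrightarrow> H2_inner (fps_const c * F) G = c * H2_inner F G"
  by (simp add: H2_inner_def mult.assoc suminf_mult[OF H2_inner_summable])

lemma H2_inner_scale_right [simp]:
  "F \<in> H2 \<Longrightarrow> G \<in> H2 \<Longrightarrow> H2_inner F (fps_const c * G) = cnj c * H2_inner F G"
  by (simp add: H2_inner_def mult.left_commute[of _ "cnj c"] suminf_mult[OF H2_inner_summable])

lemma H2_inner_minus_left [simp]: "F \<in> H2 \<Longrightarrow> G \<in> H2 \<Longrightarrow> H2_inner (- F) G = - H2_inner F G"
  using H2_inner_scale_left[of F G "-1"] by (simp flip: fps_const_neg)

lemma H2_inner_minus_right [simp]: "F \<in> H2 \<Longrightarrow> G \<in> H2 \<Longrightarrow> H2_inner F (- G) = - H2_inner F G"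
  using H2_inner_scale_right[of F G "-1"] by (simp flip: fps_const_neg)

lemma H2_inner_diff_left [simp]:
  "F \<in> H2 \<Longrightarrow> F' \<in> H2 \<Longrightarrow> G \<in> H2 \<Longrightarrow> H2_inner (F - F') G = H2_inner F G - H2_inner F' G"
  using H2_inner_add_left[of F "- F'" G] by simp

lemma H2_inner_diff_right [simp]:
  "F \<in> H2 \<Longrightarrow> G \<in> H2 \<Longrightarrow> G' \<in> H2 \<Longrightarrow> H2_inner F (G - G') = H2_inner F G - H2_inner F G'"
  using H2_inner_add_right[of F G "- G'"] by simp

lemma H2_inner_commute:
  assumes "F \<in> H2" "G \<in> H2"
  shows "H2_inner G F = cnj (H2_inner F G)"
proof -
  have "(\<lambda>n. cnj (F $ n * cnj (G $ n))) sums cnj (H2_inner F G)"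
    unfolding H2_inner_def sums_cnj using H2_inner_summable[OF assms] by (rule summable_sums)
  then show ?thesis by (simp add: H2_inner_def sums_iff mult.commute)
qed

lemma H2_inner_X_mult [simp]:
  assumes "F \<in> H2" "G \<in> H2"
  shows "H2_inner (fps_X * F) (fps_X * G) = H2_inner F G"
proof -
  have "summable (\<lambda>n. (fps_X * F) $ n * cnj ((fps_X * G) $ n))"
    by (rule H2_inner_summable) (use assms in auto)
  from suminf_split_head[OF this] show ?thesis
    by (simp add: H2_inner_def)
qed

lemma H2_norm_sq_nonneg [simp]: "F \<in> H2 \<Longrightarrow> H2_norm_sq F \<ge> 0"
  unfolding H2_norm_sq_def H2_def by (intro suminf_nonneg) auto

lemma H2_inner_self:
  assumes "F \<in> H2"
  shows "H2_inner F F = of_real (H2_norm_sq F)"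
proof -
  have "summable (\<lambda>n. (cmod (F $ n))\<^sup>2)" using assms by (simp add: H2_def)
  from suminf_of_real[OF this, where 'a = complex] show ?thesis
    by (simp add: H2_inner_def H2_norm_sq_def complex_norm_square[symmetric])
qed

lemma H2_norm_sq_eq_0_iff:
  assumes "F \<in> H2"
  shows "H2_norm_sq F = 0 \<longleftrightarrow> F = 0"
proof
  assume "H2_norm_sq F = 0"
  then have "\<forall>n. (cmod (F $ n))\<^sup>2 = 0"
    using assms suminf_eq_zero_iff[of "\<lambda>n. (cmod (F $ n))\<^sup>2"] by (simp add: H2_def H2_norm_sq_def)
  then show "F = 0" by (simp add: fps_eq_iff)
qed (simp add: H2_norm_sq_def)

lemma H2_norm_sq_diff:
  assumes "F \<in> H2" "G \<in> H2"
  shows "H2_norm_sq (F - G) = H2_norm_sq F + H2_norm_sq G - 2 * Re (H2_inner F G)"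
proof -
  have "complex_of_real (H2_norm_sq (F - G)) = of_real (H2_norm_sq F) + of_real (H2_norm_sq G) - (H2_inner F G + cnj (H2_inner F G))"
    using assms by (simp flip: H2_inner_self add: H2_inner_commute[of F G])
  also have "\<dots> = of_real (H2_norm_sq F + H2_norm_sq G - 2 * Re (H2_inner F G))"
    by (simp add: complex_add_cnj)
  finally show ?thesis by (simp only: of_real_eq_iff)
qed

lemma H2_norm_sq_add:
  assumes "F \<in> H2" "G \<in> H2"
  shows "H2_norm_sq (F + G) = H2_norm_sq F + H2_norm_sq G + 2 * Re (H2_inner F G)"
proof -
  have "H2_norm_sq (- G) = H2_norm_sq G" by (simp add: H2_norm_sq_def)
  then show ?thesis using H2_norm_sq_diff[of F "- G"] assms by simp
qed

lemma H2_norm_sq_scale: "H2_norm_sq (fps_const c * F) = (cmod c)\<^sup>2 * H2_norm_sq F" if "F \<in> H2"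
  using that by (simp add: H2_norm_sq_def H2_def norm_mult power_mult_distrib suminf_mult)

section \<open>Completeness and orthogonal projection\<close>

text \<open>
  Test the hypothesis with \<open>c = \<langle>F, G\<rangle> / (1 + \<parallel>G\<parallel>\<^sup>2)\<close>. For \<open>d = 0\<close> this is a weak
  Cauchy--Schwarz inequality; with \<open>d\<close> the squared distance of \<open>F\<close> from a subspace containing \<open>G\<close>
  it says that an almost minimal \<open>F\<close> is almost orthogonal to the subspace.
\<close>
lemma H2_inner_le_excess:
  assumes F: "F \<in> H2" and G: "G \<in> H2" and d: "\<And>c. d \<le> H2_norm_sq (F - fps_const c * G)"
  shows "(cmod (H2_inner F G))\<^sup>2 \<le> (1 + H2_norm_sq G) * (H2_norm_sq F - d)"
proof -
  define i q where "i = H2_inner F G" and "q = H2_norm_sq G"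
  define s where "s = 1 / (1 + q)"
  have q: "q \<ge> 0" using G by (simp add: q_def)
  have s: "s > 0" "s * (1 + q) = 1" using q by (simp_all add: s_def)
  have "d \<le> H2_norm_sq F + (cmod (of_real s * i))\<^sup>2 * q - 2 * Re (cnj (of_real s * i) * i)"
    using d[of "of_real s * i"] F G by (simp add: H2_norm_sq_diff H2_norm_sq_scale i_def q_def mult.assoc)
  also have "cnj (of_real s * i) * i = of_real (s * (cmod i)\<^sup>2)"
    using complex_norm_square[of i] by (simp add: mult_ac)
  finally have "d \<le> H2_norm_sq F + s\<^sup>2 * (cmod i)\<^sup>2 * q - 2 * s * (cmod i)\<^sup>2"
    using s by (simp add: norm_mult power_mult_distrib)
  moreover have "s\<^sup>2 * (cmod i)\<^sup>2 * q \<le> s * (cmod i)\<^sup>2"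
  proof -
    have "s\<^sup>2 * (cmod i)\<^sup>2 * q = (s * q) * (s * (cmod i)\<^sup>2)" by (simp add: power2_eq_square)
    also have "s * q \<le> 1" using s by (simp add: distrib_left)
    then have "(s * q) * (s * (cmod i)\<^sup>2) \<le> 1 * (s * (cmod i)\<^sup>2)"
      using s by (intro mult_right_mono) auto
    finally show ?thesis by simp
  qed
  ultimately have "s * (cmod i)\<^sup>2 \<le> H2_norm_sq F - d" by simp
  then have "(1 + q) * (s * (cmod i)\<^sup>2) \<le> (1 + q) * (H2_norm_sq F - d)"
    using q by (intro mult_left_mono) auto
  moreover have "(1 + q) * (s * (cmod i)\<^sup>2) = (cmod i)\<^sup>2"
    using s(2) by (metis mult.assoc mult.commute mult_1)
  ultimately show ?thesis unfolding i_def q_def by metis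
qed

lemma H2_coeff_le:
  assumes "F \<in> H2"
  shows "(cmod (F $ n))\<^sup>2 \<le> H2_norm_sq F"
proof -
  have "(\<Sum>i\<in>{n}. (cmod (F $ i))\<^sup>2) \<le> H2_norm_sq F"
    unfolding H2_norm_sq_def using assms by (intro sum_le_suminf) (auto simp: H2_def)
  then show ?thesis by simp
qed

text \<open>
  A Cauchy sequence converges coefficientwise. The bound on finite partial sums of
  \<open>\<parallel>F k - F j\<parallel>\<^sup>2\<close> survives the limit \<open>j \<rightarrow> \<infinity>\<close>, and then so does the bound on the full sum.
\<close>
lemma H2_complete:
  assumes F: "\<And>k. F k \<in> H2"
    and Cauchy: "\<And>e. e > 0 \<Longrightarrow> \<exists>K. \<forall>j\<ge>K. \<forall>k\<ge>K. H2_norm_sq (F j - F k) < e"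
  obtains L where "L \<in> H2" "(\<lambda>k. H2_norm_sq (F k - L)) \<longlonglongrightarrow> 0"
proof -
  have "Cauchy (\<lambda>k. F k $ n)" for n
  proof (rule metric_CauchyI)
    fix e :: real assume "e > 0"
    then obtain K where K: "\<forall>j\<ge>K. \<forall>k\<ge>K. H2_norm_sq (F j - F k) < e\<^sup>2"
      using Cauchy[of "e\<^sup>2"] by auto
    have "dist (F j $ n) (F k $ n) < e" if "j \<ge> K" "k \<ge> K" for j k
    proof -
      have "(cmod ((F j - F k) $ n))\<^sup>2 < e\<^sup>2"
        using H2_coeff_le[of "F j - F k" n] K that F by (meson H2_diff le_less_trans)
      then show ?thesis using \<open>e > 0\<close> by (simp add: dist_norm power2_less_imp_less)
    qed
    then show "\<exists>K. \<forall>j\<ge>K. \<forall>k\<ge>K. dist (F j $ n) (F k $ n) < e" by blast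
  qed
  then have "\<forall>n. \<exists>l. (\<lambda>k. F k $ n) \<longlonglongrightarrow> l"
    by (auto simp: Cauchy_convergent_iff convergent_def)
  then obtain l where l: "\<And>n. (\<lambda>k. F k $ n) \<longlonglongrightarrow> l n" by metis
  define L where "L = Abs_fps l"
  have tail: "F k - L \<in> H2 \<and> H2_norm_sq (F k - L) \<le> e"
    if e: "e > 0" and K: "\<forall>j\<ge>K. \<forall>k\<ge>K. H2_norm_sq (F j - F k) < e" and k: "k \<ge> K" for e K k
  proof -
    have partial: "(\<Sum>n<N. (cmod ((F k - L) $ n))\<^sup>2) \<le> e" for N
    proof (rule tendsto_upperbound)
      show "(\<lambda>j. \<Sum>n<N. (cmod ((F k - F j) $ n))\<^sup>2) \<longlonglongrightarrow> (\<Sum>n<N. (cmod ((F k - L) $ n))\<^sup>2)"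
        unfolding L_def fps_sub_nth fps_nth_Abs_fps by (intro tendsto_intros l)
      have "(\<Sum>n<N. (cmod ((F k - F j) $ n))\<^sup>2) \<le> e" if "j \<ge> K" for j
      proof -
        have "(\<Sum>n<N. (cmod ((F k - F j) $ n))\<^sup>2) \<le> H2_norm_sq (F k - F j)"
          unfolding H2_norm_sq_def using H2_diff[OF F F, of k j]
          by (intro sum_le_suminf) (auto simp: H2_def)
        then show ?thesis using K k that by (meson less_imp_le order.trans)
      qed
      then show "\<forall>\<^sub>F j in sequentially. (\<Sum>n<N. (cmod ((F k - F j) $ n))\<^sup>2) \<le> e"
        by (auto simp: eventually_sequentially)
    qed auto
    then have "summable (\<lambda>n. (cmod ((F k - L) $ n))\<^sup>2)"
      by (intro bounded_imp_summable[of _ e]) (use partial[of "Suc _"] in \<open>auto simp: lessThan_Suc_atMost\<close>)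
    then show ?thesis
      unfolding H2_norm_sq_def H2_def using suminf_le_const[OF _ partial] by auto
  qed
  show ?thesis
  proof (rule that)
    obtain K where "\<forall>j\<ge>K. \<forall>k\<ge>K. H2_norm_sq (F j - F k) < 1" using Cauchy[of 1] by auto
    then have "F K - L \<in> H2" using tail[of 1 K K] by simp
    then have "F K - (F K - L) \<in> H2" using F by (rule H2_diff[rotated])
    then show "L \<in> H2" by (simp only: diff_diff_eq2 add_diff_cancel_left')
    show "(\<lambda>k. H2_norm_sq (F k - L)) \<longlonglongrightarrow> 0"
    proof (rule LIMSEQ_I)
      fix e :: real assume "e > 0"
      then obtain K where "\<forall>j\<ge>K. \<forall>k\<ge>K. H2_norm_sq (F j - F k) < e / 2" using Cauchy[of "e / 2"] by auto
      then have "\<forall>k\<ge>K. 0 \<le> H2_norm_sq (F k - L) \<and> H2_norm_sq (F k - L) \<le> e / 2" using tail[of "e / 2" K] \<open>e > 0\<close> by simp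
      then show "\<exists>K. \<forall>k\<ge>K. norm (H2_norm_sq (F k - L) - 0) < e"
        using \<open>e > 0\<close> by (intro exI[of _ K]) auto
    qed
  qed
qed

text \<open>
  A sequence in \<open>M\<close> whose distances to \<open>H\<close> approach the infimum is a Cauchy sequence by the
  parallelogram law. Its members are asymptotically orthogonal to \<open>M\<close> after subtraction from \<open>H\<close>, and
  this passes to the limit \<open>P\<close>.
\<close>
lemma H2_projection:
  assumes M: "M \<subseteq> H2" "0 \<in> M"
    and add: "\<And>F G. F \<in> M \<Longrightarrow> G \<in> M \<Longrightarrow> F + G \<in> M"
    and scale: "\<And>c F. F \<in> M \<Longrightarrow> fps_const c * F \<in> M"
    and closed: "\<And>F L. (\<And>k::nat. F k \<in> M) \<Longrightarrow> L \<in> H2 \<Longrightarrow> (\<lambda>k. H2_norm_sq (F k - L)) \<longlonglongrightarrow> 0 \<Longrightarrow> L \<in> M"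
    and H: "H \<in> H2"
  obtains P where "P \<in> M" "\<And>F. F \<in> M \<Longrightarrow> H2_inner F (H - P) = 0"
proof -
  define d where "d = (INF F\<in>M. H2_norm_sq (H - F))"
  have d_le: "d \<le> H2_norm_sq (H - F)" if "F \<in> M" for F
    unfolding d_def by (rule cINF_lower[OF _ that]) (use M H in \<open>auto intro!: bdd_belowI[of _ 0] H2_norm_sq_nonneg\<close>)
  have "\<exists>F\<in>M. H2_norm_sq (H - F) < d + inverse (real (Suc k))" for k
  proof (rule ccontr)
    assume "\<not> ?thesis"
    then have "d + inverse (real (Suc k)) \<le> d"
      unfolding d_def using M(2) by (intro cINF_greatest) (auto simp: not_less)
    then show False by simp
  qed
  then obtain F where FM: "\<And>k. F k \<in> M" and F: "\<And>k. H2_norm_sq (H - F k) < d + inverse (real (Suc k))"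
    by metis
  have FH: "F k \<in> H2" for k using FM M by auto
  have minus: "- G \<in> M" if "G \<in> M" for G
    using scale[OF that, of "-1"] by (simp flip: fps_const_neg)
  \<comment> \<open>the midpoint \<open>P\<close> of two almost minimizers is at distance at least the infimum\<close>
  have near: "H2_norm_sq (F j - F k) < 2 * inverse (real (Suc j)) + 2 * inverse (real (Suc k))" for j k
  proof -
    define A B where "A = H - F j" and "B = H - F k"
    have AB: "A \<in> H2" "B \<in> H2" using H FH by (auto simp: A_def B_def)
    define P where "P = fps_const (1/2) * (F j + F k)"
    have "P \<in> M" unfolding P_def by (intro scale add FM)
    then have "d \<le> H2_norm_sq (H - P)" by (rule d_le)
    moreover have "H - P = fps_const (1/2) * (A + B)"
    proof (rule fps_ext)
      show "(H - P) $ n = (fps_const (1/2) * (A + B)) $ n" for n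
        unfolding P_def A_def B_def fps_sub_nth fps_mult_left_const_nth fps_add_nth
        by (simp add: field_simps)
    qed
    ultimately have "4 * d \<le> H2_norm_sq A + H2_norm_sq B + 2 * Re (H2_inner A B)"
      using AB by (simp add: H2_norm_sq_scale H2_norm_sq_add power2_eq_square)
    moreover have "H2_norm_sq (F j - F k) = H2_norm_sq (A - B)"
      by (simp add: A_def B_def H2_norm_sq_def norm_minus_commute)
    ultimately show ?thesis
      using F[of j] F[of k] AB by (simp add: H2_norm_sq_diff flip: A_def B_def)
  qed
  have inv0: "(\<lambda>k. inverse (real (Suc k))) \<longlonglongrightarrow> 0" by (rule LIMSEQ_inverse_real_of_nat)
  have Cauchy: "\<exists>K. \<forall>j\<ge>K. \<forall>k\<ge>K. H2_norm_sq (F j - F k) < e" if "e > 0" for e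
  proof -
    have "\<forall>\<^sub>F k in sequentially. inverse (real (Suc k)) < e / 4"
      using order_tendstoD(2)[OF inv0, of "e / 4"] that by simp
    then obtain K where K: "\<And>k. k \<ge> K \<Longrightarrow> inverse (real (Suc k)) < e / 4"
      by (auto simp: eventually_sequentially)
    have "H2_norm_sq (F j - F k) < e" if "j \<ge> K" "k \<ge> K" for j k
      using near[of j k] K[of j] K[of k] that by linarith
    then show ?thesis by blast
  qed
  obtain P where P: "P \<in> H2" "(\<lambda>k. H2_norm_sq (F k - P)) \<longlonglongrightarrow> 0"
    using H2_complete[OF FH Cauchy] by blast
  show ?thesis
  proof (rule that)
    show "P \<in> M" using closed[OF FM P] .
    fix G assume G: "G \<in> M"
    then have GH: "G \<in> H2" using M by auto
    have lim: "(\<lambda>k. X k) \<longlonglongrightarrow> 0"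
      if "\<And>k. (cmod (X k))\<^sup>2 \<le> (1 + H2_norm_sq G) * e k" "e \<longlonglongrightarrow> 0" for X :: "nat \<Rightarrow> complex" and e
    proof -
      have "(\<lambda>k. (1 + H2_norm_sq G) * e k) \<longlonglongrightarrow> 0"
        using tendsto_mult_right_zero[OF that(2)] .
      then have "(\<lambda>k. (cmod (X k))\<^sup>2) \<longlonglongrightarrow> 0"
        by (rule Lim_null_comparison[rotated]) (use that(1) in auto)
      then have "(\<lambda>k. sqrt ((cmod (X k))\<^sup>2)) \<longlonglongrightarrow> sqrt 0" by (rule tendsto_real_sqrt)
      then show ?thesis by (simp add: tendsto_norm_zero_iff)
    qed
    have 1: "(\<lambda>k. H2_inner (H - F k) G) \<longlonglongrightarrow> 0"
    proof (rule lim[OF _ inv0])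
      fix k
      have "(cmod (H2_inner (H - F k) G))\<^sup>2 \<le> (1 + H2_norm_sq G) * (H2_norm_sq (H - F k) - d)"
        using d_le[OF add[OF FM[of k] scale[OF G]]] H FH GH
        by (intro H2_inner_le_excess) (auto simp: diff_diff_add)
      also have "\<dots> \<le> (1 + H2_norm_sq G) * inverse (real (Suc k))"
        using F[of k] H2_norm_sq_nonneg[OF GH] by (intro mult_left_mono) linarith+
      finally show "(cmod (H2_inner (H - F k) G))\<^sup>2 \<le> (1 + H2_norm_sq G) * inverse (real (Suc k))" .
    qed
    have 2: "(\<lambda>k. H2_inner (F k - P) G) \<longlonglongrightarrow> 0"
    proof (rule lim[OF _ P(2)])
      fix k
      have "(cmod (H2_inner (F k - P) G))\<^sup>2 \<le> (1 + H2_norm_sq G) * (H2_norm_sq (F k - P) - 0)"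
        using FH P GH by (intro H2_inner_le_excess) auto
      then show "(cmod (H2_inner (F k - P) G))\<^sup>2 \<le> (1 + H2_norm_sq G) * H2_norm_sq (F k - P)" by simp
    qed
    have "H2_inner (H - F k) G + H2_inner (F k - P) G = H2_inner (H - P) G" for k
      using H FH P GH by simp
    with tendsto_add[OF 1 2] have "H2_inner (H - P) G = 0"
      by (simp add: LIMSEQ_const_iff)
    then show "H2_inner G (H - P) = 0"
      using H P GH H2_inner_commute[of "H - P" G] by simp
  qed
qed

section \<open>Multipliers and inner functions\<close>

text \<open>
  The Taylor series of \<open>1 / (1 - r * z)\<close>. For \<open>r = cnj w\<close> it is the Szego kernel, which reproduces
  the value at \<open>w\<close>.
\<close>
definition geometric :: "complex \<Rightarrow> complex fps" where
  "geometric r = Abs_fps (\<lambda>n. r ^ n)"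

lemma geometric_inverse: "(1 - fps_const r * fps_X) * geometric r = 1"
proof (rule fps_ext)
  fix n
  show "((1 - fps_const r * fps_X) * geometric r) $ n = 1 $ n"
    by (cases n) (simp_all add: geometric_def left_diff_distrib mult.assoc)
qed

lemma geometric_deriv: "fps_deriv (geometric r) = fps_const r * geometric r * geometric r"
proof -
  have "0 = geometric r * fps_deriv ((1 - fps_const r * fps_X) * geometric r)"
    unfolding geometric_inverse by simp
  also have "\<dots> = ((1 - fps_const r * fps_X) * geometric r) * fps_deriv (geometric r) - fps_const r * geometric r * geometric r"
    by (simp add: algebra_simps)
  finally show ?thesis unfolding geometric_inverse by simp
qed

lemma H2_inner_geometric: "H2_inner F (geometric (cnj z)) = eval_fps F z"
  by (simp add: H2_inner_def geometric_def eval_fps_def)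

definition H2_multiplier :: "complex fps \<Rightarrow> bool" where
  "H2_multiplier A \<longleftrightarrow> (\<forall>F\<in>H2. A * F \<in> H2)"

lemma H2_multiplierD [simp]: "H2_multiplier A \<Longrightarrow> F \<in> H2 \<Longrightarrow> A * F \<in> H2"
  by (simp add: H2_multiplier_def)

lemma H2_multiplier_const [simp]: "H2_multiplier (fps_const c)"
  by (simp add: H2_multiplier_def)

lemma H2_multiplier_X [simp]: "H2_multiplier fps_X"
  by (simp add: H2_multiplier_def)

lemma H2_multiplier_1 [simp]: "H2_multiplier 1"
  by (simp add: H2_multiplier_def)

lemma H2_multiplier_add [simp]: "H2_multiplier A \<Longrightarrow> H2_multiplier B \<Longrightarrow> H2_multiplier (A + B)"
  by (simp add: H2_multiplier_def distrib_right)

lemma H2_multiplier_diff [simp]: "H2_multiplier A \<Longrightarrow> H2_multiplier B \<Longrightarrow> H2_multiplier (A - B)"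
  by (simp add: H2_multiplier_def left_diff_distrib)

lemma H2_multiplier_mult [simp]: "H2_multiplier A \<Longrightarrow> H2_multiplier B \<Longrightarrow> H2_multiplier (A * B)"
  by (simp add: H2_multiplier_def mult.assoc)

lemma H2_multiplier_power [simp]: "H2_multiplier A \<Longrightarrow> H2_multiplier (A ^ n)"
  by (induction n) auto

lemma H2_multiplier_in_H2: "H2_multiplier A \<Longrightarrow> A \<in> H2"
  using H2_multiplierD[of A 1] by simp

text \<open>
  The quotient \<open>G = F / (1 - r X)\<close> satisfies \<open>G $ Suc n = F $ Suc n + r * G $ n\<close>. By convexity
  \<open>\<bar>G $ Suc n\<bar>\<^sup>2 \<le> \<bar>F $ Suc n\<bar>\<^sup>2 / (1 - \<bar>r\<bar>) + \<bar>r\<bar> * \<bar>G $ n\<bar>\<^sup>2\<close>, so each partial sum of the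
  \<open>\<bar>G $ n\<bar>\<^sup>2\<close> is at most a fixed multiple of \<open>\<parallel>F\<parallel>\<^sup>2\<close> plus \<open>\<bar>r\<bar> < 1\<close> times itself.
\<close>
lemma H2_multiplier_geometric [simp]:
  assumes "cmod r < 1"
  shows "H2_multiplier (geometric r)"
  unfolding H2_multiplier_def
proof
  fix F assume F: "F \<in> H2"
  define G where "G = geometric r * F"
  define t where "t = cmod r"
  have t: "0 \<le> t" "t < 1" using assms by (simp_all add: t_def)
  have "F = ((1 - fps_const r * fps_X) * geometric r) * F" unfolding geometric_inverse by simp
  then have FG: "F = G - fps_const r * (fps_X * G)" by (simp add: G_def algebra_simps)
  have rec: "G $ Suc n = F $ Suc n + r * G $ n" for n
    by (subst FG) simp
  have G0: "G $ 0 = F $ 0" by (subst FG) simp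
  have step: "(cmod (G $ Suc n))\<^sup>2 \<le> (cmod (F $ Suc n))\<^sup>2 / (1 - t) + t * (cmod (G $ n))\<^sup>2" for n
  proof -
    define x y where "x = cmod (F $ Suc n)" and "y = cmod (G $ n)"
    have "cmod (G $ Suc n) \<le> x + t * y"
      unfolding rec x_def y_def t_def norm_mult[symmetric] by (rule norm_triangle_ineq)
    then have "(cmod (G $ Suc n))\<^sup>2 \<le> (x + t * y)\<^sup>2" by (intro power_mono) auto
    also have "\<dots> \<le> x\<^sup>2 / (1 - t) + t * y\<^sup>2"
    proof -
      have "(1 - t) * (x + t * y)\<^sup>2 + t * (x - (1 - t) * y)\<^sup>2 = x\<^sup>2 + (1 - t) * (t * y\<^sup>2)"
        by (simp add: algebra_simps power2_eq_square)
      moreover have "0 \<le> t * (x - (1 - t) * y)\<^sup>2" using t by simp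
      ultimately have "(1 - t) * (x + t * y)\<^sup>2 \<le> x\<^sup>2 + (1 - t) * (t * y\<^sup>2)" by linarith
      then show ?thesis using t by (simp add: field_simps)
    qed
    finally show ?thesis by (simp add: x_def y_def)
  qed
  have "summable (\<lambda>n. (cmod (G $ n))\<^sup>2)"
  proof (rule bounded_imp_summable)
    fix N
    have FN: "(\<Sum>n\<le>N. (cmod (F $ n))\<^sup>2) \<le> H2_norm_sq F"
      unfolding H2_norm_sq_def using F by (intro sum_le_suminf) (auto simp: H2_def)
    have "(\<Sum>n\<le>N. (cmod (G $ n))\<^sup>2) \<le> (\<Sum>n\<le>N. (cmod (F $ n))\<^sup>2) / (1 - t) + t * (\<Sum>n\<le>N. (cmod (G $ n))\<^sup>2)"
    proof (induction N)
      case 0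
      have "(cmod (F $ 0))\<^sup>2 * (1 - t) \<le> (cmod (F $ 0))\<^sup>2" using t by (simp add: mult_left_le)
      then have "(cmod (F $ 0))\<^sup>2 \<le> (cmod (F $ 0))\<^sup>2 / (1 - t)" using t by (simp add: pos_le_divide_eq)
      then show ?case using t G0 by (simp add: add_increasing2)
    next
      case (Suc N)
      have "(\<Sum>n\<le>Suc N. (cmod (G $ n))\<^sup>2) = (cmod (G $ 0))\<^sup>2 + (\<Sum>n\<le>N. (cmod (G $ Suc n))\<^sup>2)"
        by (rule sum.atMost_Suc_shift)
      also have "\<dots> \<le> (cmod (F $ 0))\<^sup>2 / (1 - t) + (\<Sum>n\<le>N. (cmod (F $ Suc n))\<^sup>2 / (1 - t) + t * (cmod (G $ n))\<^sup>2)"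
      proof (intro add_mono sum_mono step)
        have "(cmod (F $ 0))\<^sup>2 * (1 - t) \<le> (cmod (F $ 0))\<^sup>2" using t by (simp add: mult_left_le)
        then show "(cmod (G $ 0))\<^sup>2 \<le> (cmod (F $ 0))\<^sup>2 / (1 - t)"
          using t G0 by (simp add: pos_le_divide_eq)
      qed
      also have "\<dots> = (\<Sum>n\<le>Suc N. (cmod (F $ n))\<^sup>2) / (1 - t) + t * (\<Sum>n\<le>N. (cmod (G $ n))\<^sup>2)"
        by (subst sum.atMost_Suc_shift)
          (simp add: sum.distrib sum_distrib_left sum_divide_distrib add_divide_distrib)
      also have "\<dots> \<le> (\<Sum>n\<le>Suc N. (cmod (F $ n))\<^sup>2) / (1 - t) + t * (\<Sum>n\<le>Suc N. (cmod (G $ n))\<^sup>2)"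
        using t by (intro add_left_mono mult_left_mono) auto
      finally show ?case .
    qed
    then have "(1 - t) * (\<Sum>n\<le>N. (cmod (G $ n))\<^sup>2) \<le> (\<Sum>n\<le>N. (cmod (F $ n))\<^sup>2) / (1 - t)"
      by (simp add: left_diff_distrib)
    also have "\<dots> \<le> H2_norm_sq F / (1 - t)" using FN t by (intro divide_right_mono) auto
    finally show "(\<Sum>n\<le>N. (cmod (G $ n))\<^sup>2) \<le> H2_norm_sq F / (1 - t) / (1 - t)"
      using t by (subst pos_le_divide_eq) (auto simp: mult.commute)
  qed auto
  then show "geometric r * F \<in> H2" by (simp add: H2_def G_def)
qed

definition H2_isometric :: "complex fps \<Rightarrow> bool" where
  "H2_isometric A \<longleftrightarrow> H2_multiplier A \<and> (\<forall>F\<in>H2. \<forall>G\<in>H2. H2_inner (A * F) (A * G) = H2_inner F G)"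

lemma H2_isometric_inner: 
  "H2_isometric A \<Longrightarrow> F \<in> H2 \<Longrightarrow> G \<in> H2 \<Longrightarrow> H2_inner (A * F) (A * G) = H2_inner F G"
  by (simp add: H2_isometric_def)

lemma H2_isometric_multiplier: "H2_isometric A \<Longrightarrow> H2_multiplier A"
  by (simp add: H2_isometric_def)

lemma H2_isometric_mult: "H2_isometric A \<Longrightarrow> H2_isometric B \<Longrightarrow> H2_isometric (A * B)"
  by (auto simp: H2_isometric_def mult.assoc)

lemma H2_isometric_const: "cmod c = 1 \<Longrightarrow> H2_isometric (fps_const c)"
  using complex_norm_square[of c]
  by (auto simp: H2_isometric_def mult.assoc[symmetric] mult.commute[of "cnj c"])

lemma H2_isometric_power: "H2_isometric A \<Longrightarrow> H2_isometric (A ^ n)"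
proof (induction n)
  case 0
  then show ?case using H2_isometric_const[of 1] by simp
qed (auto intro: H2_isometric_mult)

definition blaschke_factor :: "complex \<Rightarrow> complex fps" where
  "blaschke_factor a = (fps_const a - fps_X) * geometric (cnj a)"

text \<open>
  On the unit circle \<open>\<bar>a - z\<bar> = \<bar>1 - cnj a * z\<bar>\<close>. The corresponding identity for inner products
  needs only that multiplication by \<open>X\<close> is isometric.
\<close>
lemma H2_isometric_blaschke_factor:
  assumes "cmod a < 1"
  shows "H2_isometric (blaschke_factor a)"
  unfolding H2_isometric_def
proof (intro conjI ballI)
  show "H2_multiplier (blaschke_factor a)" using assms by (simp add: blaschke_factor_def)
  fix F G assume FG: "F \<in> H2" "G \<in> H2"
  have ex: "\<exists>V\<in>H2. blaschke_factor a * F = fps_const a * V - fps_X * V \<and> F = V - fps_const (cnj a) * (fps_X * V)"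
    if "F \<in> H2" for F
  proof (intro bexI conjI)
    show "geometric (cnj a) * F \<in> H2" using assms that by simp
    have "F = ((1 - fps_const (cnj a) * fps_X) * geometric (cnj a)) * F" unfolding geometric_inverse by simp
    then show "F = geometric (cnj a) * F - fps_const (cnj a) * (fps_X * (geometric (cnj a) * F))"
      by (simp add: algebra_simps)
  qed (simp add: blaschke_factor_def algebra_simps)
  obtain V where V: "V \<in> H2" "blaschke_factor a * F = fps_const a * V - fps_X * V" 
    "F = V - fps_const (cnj a) * (fps_X * V)" using ex[OF FG(1)] by blast
  obtain W where W: "W \<in> H2" "blaschke_factor a * G = fps_const a * W - fps_X * W" 
    "G = W - fps_const (cnj a) * (fps_X * W)" using ex[OF FG(2)] by blast
  have "H2_inner (blaschke_factor a * F) (blaschke_factor a * G) = 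
    H2_inner (V - fps_const (cnj a) * (fps_X * V)) (W - fps_const (cnj a) * (fps_X * W))"
    unfolding V(2) W(2) using V(1) W(1) by (simp, simp add: algebra_simps)
  then show "H2_inner (blaschke_factor a * F) (blaschke_factor a * G) = H2_inner F G"
    using V W by simp
qed

section \<open>Orthogonality along the powers of an inner function\<close>

text \<open>
  The inner product of \<open>S\<^sup>2\<close> in terms of Taylor series: the terms with \<open>n \<ge> 1\<close> form the Hardy space
  inner product of the derivatives.
\<close>
definition S2_fps_inner :: "complex fps \<Rightarrow> complex fps \<Rightarrow> complex" where
  "S2_fps_inner F G = F $ 0 * cnj (G $ 0) + H2_inner (fps_deriv F) (fps_deriv G)"

lemma H2_of_deriv:
  assumes "fps_deriv F \<in> H2"
  shows "F \<in> H2"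
proof -
  have "summable (\<lambda>n. (cmod (F $ Suc n))\<^sup>2)"
  proof (rule summable_comparison_test')
    show "summable (\<lambda>n. (cmod (fps_deriv F $ n))\<^sup>2)" using assms by (simp add: H2_def)
    fix n
    have "1 * cmod (F $ Suc n) \<le> real (Suc n) * cmod (F $ Suc n)"
      by (intro mult_right_mono) auto
    also have "\<dots> = cmod (fps_deriv F $ n)"
      unfolding fps_deriv_nth norm_mult by (simp del: of_nat_Suc of_nat_add flip: Suc_eq_plus1)
    finally show "norm ((cmod (F $ Suc n))\<^sup>2) \<le> (cmod (fps_deriv F $ n))\<^sup>2"
      by (simp add: power_mono)
  qed
  then show ?thesis by (simp add: H2_def summable_Suc_iff[of "\<lambda>n. (cmod (F $ n))\<^sup>2"])
qed

text \<open>
  Divide by the highest remaining power of \<open>n\<close> and let \<open>n \<rightarrow> \<infinity>\<close>, three times.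
\<close>
lemma quadratic_plus_decay_eq_zero:
  fixes A B C x q :: complex
  assumes q: "cmod q < 1"
    and eq: "\<And>n. n \<ge> 1 \<Longrightarrow> (of_nat n)\<^sup>2 * A + of_nat n * B + C + q ^ n * x = 0"
  shows "A = 0" "B = 0" "C = 0"
proof -
  define e :: "nat \<Rightarrow> complex" where "e n = inverse (of_nat n)" for n
  have e: "e \<longlonglongrightarrow> 0" unfolding e_def by (rule lim_inverse_n)
  have qn: "(\<lambda>n. q ^ n) \<longlonglongrightarrow> 0" using q by (rule LIMSEQ_power_zero)
  have zero: "a = 0" if "r \<longlonglongrightarrow> 0" "\<And>n. n \<ge> 1 \<Longrightarrow> a + r n = 0" for a :: complex and r
  proof -
    have "(\<lambda>n. a + r n) \<longlonglongrightarrow> a + 0" by (intro tendsto_intros that)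
    moreover have "(\<lambda>n. a + r n) \<longlonglongrightarrow> 0"
      by (rule tendsto_eventually) (use that(2) in \<open>auto simp: eventually_sequentially\<close>)
    ultimately show ?thesis using LIMSEQ_unique by fastforce
  qed
  show A: "A = 0"
  proof (rule zero)
    show "(\<lambda>n. e n * B + (e n)\<^sup>2 * (C + q ^ n * x)) \<longlonglongrightarrow> 0"
      by (rule tendsto_eq_intros e qn refl)+ simp
    fix n :: nat assume n: "n \<ge> 1"
    have "A + (e n * B + (e n)\<^sup>2 * (C + q ^ n * x)) = (e n)\<^sup>2 * ((of_nat n)\<^sup>2 * A + of_nat n * B + C + q ^ n * x)"
      using n by (simp add: e_def field_simps power2_eq_square)
    then show "A + (e n * B + (e n)\<^sup>2 * (C + q ^ n * x)) = 0" unfolding eq[OF n] by simp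
  qed
  show B: "B = 0"
  proof (rule zero)
    show "(\<lambda>n. e n * (C + q ^ n * x)) \<longlonglongrightarrow> 0"
      by (rule tendsto_eq_intros e qn refl)+ simp
    fix n :: nat assume n: "n \<ge> 1"
    have "B + e n * (C + q ^ n * x) = e n * ((of_nat n)\<^sup>2 * A + of_nat n * B + C + q ^ n * x)"
      using n A by (simp add: e_def field_simps)
    then show "B + e n * (C + q ^ n * x) = 0" unfolding eq[OF n] by simp
  qed
  show "C = 0"
  proof (rule zero)
    show "(\<lambda>n. q ^ n * x) \<longlonglongrightarrow> 0"
      by (rule tendsto_eq_intros qn refl)+ simp
  qed (use eq A B in simp)
qed

text \<open>
  By the product rule \<open>(\<Psi>\<^sup>n F)' = \<Psi>\<^sup>n\<^sup>-\<^sup>1 (n \<Psi>' F + \<Psi> F')\<close>, and the factor \<open>\<Psi>\<^sup>n\<^sup>-\<^sup>1\<close> is isometric. Hence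
  \<open>\<langle>\<Psi>\<^sup>n F, \<Psi>\<^sup>n G\<rangle>\<close> is a quadratic polynomial in \<open>n\<close> plus the decaying term
  \<open>\<bar>\<Psi> $ 0\<bar>\<^sup>2\<^sup>n * (F $ 0 * cnj (G $ 0))\<close>. If the inner product vanishes for all \<open>n\<close>, each coefficient
  vanishes separately. The last conclusion is the one that forces a reducing subspace or its complement
  to consist of functions that are zero at the origin.
\<close>
lemma S2_fps_inner_power_orthogonal:
  assumes iso: "H2_isometric \<Psi>" and mult: "H2_multiplier (fps_deriv \<Psi>)" and q: "cmod (\<Psi> $ 0) < 1"
    and F': "fps_deriv F \<in> H2" and G': "fps_deriv G \<in> H2"
    and orth: "\<And>n. S2_fps_inner (\<Psi> ^ n * F) (\<Psi> ^ n * G) = 0"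
  shows "H2_inner (fps_deriv \<Psi> * F) (fps_deriv \<Psi> * G) = 0"
    and "H2_inner (fps_deriv \<Psi> * F) (\<Psi> * fps_deriv G) + H2_inner (\<Psi> * fps_deriv F) (fps_deriv \<Psi> * G) = 0"
    and "H2_inner (fps_deriv F) (fps_deriv G) = 0"
    and "F $ 0 * cnj (G $ 0) = 0"
proof -
  note [simp] = F' G' H2_of_deriv[OF F'] H2_of_deriv[OF G'] mult H2_isometric_multiplier[OF iso]
  have deriv: "fps_deriv (\<Psi> ^ n * F) = \<Psi> ^ (n - 1) * (fps_const (of_nat n) * (fps_deriv \<Psi> * F) + \<Psi> * fps_deriv F)"
    if "n \<ge> 1" for n F
  proof -
    from that obtain m where n: "n = Suc m" by (cases n) auto
    have "fps_deriv (\<Psi> ^ Suc m) = fps_const (of_nat (Suc m)) * fps_deriv \<Psi> * \<Psi> ^ m"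
      using fps_deriv_power[of \<Psi> "Suc m"] by simp
    then show ?thesis
      unfolding n fps_deriv_mult by (simp add: algebra_simps del: of_nat_Suc fps_of_nat)
  qed
  have *: "(of_nat n)\<^sup>2 * H2_inner (fps_deriv \<Psi> * F) (fps_deriv \<Psi> * G)
      + of_nat n * (H2_inner (fps_deriv \<Psi> * F) (\<Psi> * fps_deriv G) + H2_inner (\<Psi> * fps_deriv F) (fps_deriv \<Psi> * G))
      + H2_inner (fps_deriv F) (fps_deriv G) + (\<Psi> $ 0 * cnj (\<Psi> $ 0)) ^ n * (F $ 0 * cnj (G $ 0)) = 0"
    if n: "n \<ge> 1" for n
  proof -
    have "S2_fps_inner (\<Psi> ^ n * F) (\<Psi> ^ n * G) = (\<Psi> $ 0 * cnj (\<Psi> $ 0)) ^ n * (F $ 0 * cnj (G $ 0)) +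
      H2_inner (fps_const (of_nat n) * (fps_deriv \<Psi> * F) + \<Psi> * fps_deriv F)
        (fps_const (of_nat n) * (fps_deriv \<Psi> * G) + \<Psi> * fps_deriv G)"
      unfolding S2_fps_inner_def deriv[OF n]
      by (subst H2_isometric_inner[OF H2_isometric_power[OF iso]])
        (simp_all add: fps_power_zeroth power_mult_distrib del: fps_of_nat)
    also have "\<dots> = (of_nat n)\<^sup>2 * H2_inner (fps_deriv \<Psi> * F) (fps_deriv \<Psi> * G)
      + of_nat n * (H2_inner (fps_deriv \<Psi> * F) (\<Psi> * fps_deriv G) + H2_inner (\<Psi> * fps_deriv F) (fps_deriv \<Psi> * G))
      + H2_inner (\<Psi> * fps_deriv F) (\<Psi> * fps_deriv G) + (\<Psi> $ 0 * cnj (\<Psi> $ 0)) ^ n * (F $ 0 * cnj (G $ 0))"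
      by (simp del: fps_of_nat, simp add: algebra_simps power2_eq_square)
    finally show ?thesis using orth[of n] by (simp add: H2_isometric_inner[OF iso])
  qed
  have q2: "cmod (\<Psi> $ 0 * cnj (\<Psi> $ 0)) < 1"
    using q mult_strict_mono'[of "cmod (\<Psi> $ 0)" 1 "cmod (\<Psi> $ 0)" 1] by (simp add: norm_mult)
  note res = quadratic_plus_decay_eq_zero[OF q2 *]
  show "H2_inner (fps_deriv \<Psi> * F) (fps_deriv \<Psi> * G) = 0"
    "H2_inner (fps_deriv \<Psi> * F) (\<Psi> * fps_deriv G) + H2_inner (\<Psi> * fps_deriv F) (fps_deriv \<Psi> * G) = 0"
    by (rule res; assumption)+
  show C: "H2_inner (fps_deriv F) (fps_deriv G) = 0" by (rule res)
  show "F $ 0 * cnj (G $ 0) = 0" using orth[of 0] C by (simp add: S2_fps_inner_def)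
qed

text \<open>
  Here \<open>S2_fps_inner_power_orthogonal\<close> is used with \<open>\<Psi>\<^sup>k\<close> for \<open>F\<close>, and with \<open>G\<close> and \<open>\<Psi> G\<close> in the second
  argument. The factor \<open>\<Psi>\<close> on the right of both conclusions makes the zeros of \<open>\<Psi>\<close> invisible in
  \<open>blaschke2_trace_eq_zero\<close>.
\<close>
lemma S2_fps_inner_orthogonal_to_powers:
  assumes iso: "H2_isometric \<Psi>" and mult: "H2_multiplier (fps_deriv \<Psi>)" and q: "cmod (\<Psi> $ 0) < 1"
    and G': "fps_deriv G \<in> H2"
    and orth: "\<And>k m. S2_fps_inner (\<Psi> ^ k) (\<Psi> ^ m * G) = 0"
  shows "H2_inner (fps_deriv \<Psi> * \<Psi> ^ k) (\<Psi> * fps_deriv G) = 0"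
    and "H2_inner (fps_deriv \<Psi> * \<Psi> ^ k) (\<Psi> * (fps_deriv \<Psi> * G)) = 0"
proof -
  note [simp] = G' H2_of_deriv[OF G'] mult H2_isometric_multiplier[OF iso] H2_multiplier_in_H2
  have dk: "fps_deriv (\<Psi> ^ k) = fps_const (of_nat k) * (fps_deriv \<Psi> * \<Psi> ^ (k - 1))"
    by (simp add: fps_deriv_power mult.assoc del: fps_of_nat)
  have F: "fps_deriv (\<Psi> ^ k) \<in> H2"
    unfolding dk by (intro H2_const_mult H2_multiplierD) simp_all
  have or: "S2_fps_inner (\<Psi> ^ n * \<Psi> ^ k) (\<Psi> ^ n * (\<Psi> ^ m * G)) = 0" for n m
    using orth[of "n + k" "n + m"] by (simp add: power_add mult.assoc)
  have G1: "fps_deriv (\<Psi> * G) \<in> H2" by simp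
  show "H2_inner (fps_deriv \<Psi> * \<Psi> ^ k) (\<Psi> * (fps_deriv \<Psi> * G)) = 0"
    using S2_fps_inner_power_orthogonal(1)[OF iso mult q F G1] or[of _ 1] by (simp add: mult_ac)
  have or0: "S2_fps_inner (\<Psi> ^ n * \<Psi> ^ k) (\<Psi> ^ n * G) = 0" for n
    using or[of n 0] by simp
  have A: "H2_inner (fps_deriv \<Psi> * \<Psi> ^ k) (fps_deriv \<Psi> * G) = 0"
    by (rule S2_fps_inner_power_orthogonal(1)[OF iso mult q F G' or0])
  have "\<Psi> * fps_deriv (\<Psi> ^ k) = fps_const (of_nat k) * (fps_deriv \<Psi> * \<Psi> ^ k)"
    unfolding dk by (cases k) (simp_all add: mult_ac del: fps_of_nat of_nat_Suc)
  then have "H2_inner (\<Psi> * fps_deriv (\<Psi> ^ k)) (fps_deriv \<Psi> * G) = 0"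
    using A by (simp del: fps_of_nat)
  then show "H2_inner (fps_deriv \<Psi> * \<Psi> ^ k) (\<Psi> * fps_deriv G) = 0"
    using S2_fps_inner_power_orthogonal(2)[OF iso mult q F G' or0] by simp
qed

section \<open>Evaluation at points of the disk\<close>

lemma H2_geometric [simp]: "cmod r < 1 \<Longrightarrow> geometric r \<in> H2"
  by (simp add: H2_multiplier_in_H2)

lemma H2_conv_radius:
  assumes "F \<in> H2"
  shows "fps_conv_radius F \<ge> 1"
  unfolding fps_conv_radius_def
proof (rule conv_radius_geI_ex')
  fix r :: real assume r: "0 < r" "ereal r < 1"
  then have "geometric (of_real r) \<in> H2" by simp
  from H2_inner_summable[OF assms this] show "summable (\<lambda>n. F $ n * of_real r ^ n)"
    by (simp add: geometric_def)
qed

lemma H2_in_conv_radius: "F \<in> H2 \<Longrightarrow> cmod z < 1 \<Longrightarrow> ereal (cmod z) < fps_conv_radius F"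
  using H2_conv_radius[of F] by (meson ereal_less(3) less_le_trans)

lemma H2_eval_mult:
  "F \<in> H2 \<Longrightarrow> G \<in> H2 \<Longrightarrow> cmod z < 1 \<Longrightarrow> eval_fps (F * G) z = eval_fps F z * eval_fps G z"
  by (simp add: eval_fps_mult H2_in_conv_radius)

lemma eval_geometric:
  assumes "cmod r < 1" "cmod z < 1"
  shows "eval_fps (geometric r) z = 1 / (1 - r * z)"
proof -
  have 1: "1 - fps_const r * fps_X \<in> H2"
    by (intro H2_multiplier_in_H2) simp
  have "1 = eval_fps ((1 - fps_const r * fps_X) * geometric r) z"
    unfolding geometric_inverse by simp
  also have "\<dots> = eval_fps (1 - fps_const r * fps_X) z * eval_fps (geometric r) z"
    using assms 1 by (intro H2_eval_mult) auto
  also have "eval_fps (1 - fps_const r * fps_X) z = 1 - r * z"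
    using assms by (simp add: eval_fps_diff eval_fps_mult H2_in_conv_radius H2_multiplier_in_H2)
  finally have "(1 - r * z) * eval_fps (geometric r) z = 1" by simp
  then show ?thesis by (metis mult_zero_left nonzero_mult_div_cancel_left zero_neq_one)
qed

lemma eval_blaschke_factor:
  assumes "cmod a < 1" "cmod z < 1"
  shows "eval_fps (blaschke_factor a) z = disk_aut a z"
proof -
  have "fps_const a - fps_X \<in> H2" by (intro H2_multiplier_in_H2) simp
  then have "eval_fps (blaschke_factor a) z = eval_fps (fps_const a - fps_X) z * eval_fps (geometric (cnj a)) z"
    using assms unfolding blaschke_factor_def by (intro H2_eval_mult) auto
  then show ?thesis
    using assms by (simp add: eval_geometric disk_aut_def eval_fps_diff)
qed

definition blaschke2 :: "complex \<Rightarrow> complex \<Rightarrow> complex \<Rightarrow> complex fps" where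
  "blaschke2 c a b = fps_const c * (blaschke_factor a * blaschke_factor b)"

lemma H2_isometric_blaschke2: "cmod c = 1 \<Longrightarrow> cmod a < 1 \<Longrightarrow> cmod b < 1 \<Longrightarrow> H2_isometric (blaschke2 c a b)"
  unfolding blaschke2_def
  by (intro H2_isometric_mult H2_isometric_const H2_isometric_blaschke_factor)

lemma H2_multiplier_deriv_blaschke2:
  assumes "cmod a < 1" "cmod b < 1"
  shows "H2_multiplier (fps_deriv (blaschke2 c a b))"
proof -
  have B: "H2_multiplier (blaschke_factor a) \<and> H2_multiplier (fps_deriv (blaschke_factor a))"
    if "cmod a < 1" for a
    using that by (simp add: blaschke_factor_def geometric_deriv)
  show ?thesis using B[OF assms(1)] B[OF assms(2)] by (simp add: blaschke2_def)
qed

lemma eval_blaschke2: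
  assumes "cmod c = 1" "cmod a < 1" "cmod b < 1" "cmod z < 1"
  shows "eval_fps (blaschke2 c a b) z = c * (disk_aut a z * disk_aut b z)"
proof -
  have B: "H2_multiplier (blaschke_factor u)" if "cmod u < 1" for u
    using that by (intro H2_isometric_multiplier H2_isometric_blaschke_factor)
  have "eval_fps (blaschke2 c a b) z = eval_fps (fps_const c) z * eval_fps (blaschke_factor a * blaschke_factor b) z"
    unfolding blaschke2_def using assms by (intro H2_eval_mult H2_multiplier_in_H2 H2_multiplier_mult B) auto
  also have "eval_fps (blaschke_factor a * blaschke_factor b) z = disk_aut a z * disk_aut b z"
    using assms by (subst H2_eval_mult) (auto intro!: H2_multiplier_in_H2 B simp: eval_blaschke_factor)
  finally show ?thesis by simp
qed

lemma disk_aut_denom_nonzero: "cmod a < 1 \<Longrightarrow> cmod z < 1 \<Longrightarrow> 1 - cnj a * z \<noteq> 0"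
proof
  assume "cmod a < 1" "cmod z < 1" "1 - cnj a * z = 0"
  then have "cmod (cnj a * z) = 1" "cmod (cnj a) * cmod z < 1"
    using mult_strict_mono[of "cmod a" 1 "cmod z" 1] by auto
  then show False by (simp add: norm_mult)
qed

lemma cmod_disk_aut_less_1:
  assumes "cmod a < 1" "cmod z < 1"
  shows "cmod (disk_aut a z) < 1"
proof -
  have "(cmod (1 - cnj a * z))\<^sup>2 - (cmod (a - z))\<^sup>2 = (1 - (cmod a)\<^sup>2) * (1 - (cmod z)\<^sup>2)"
    unfolding cmod_power2 by (simp add: algebra_simps power2_eq_square)
  moreover have "(1 - (cmod a)\<^sup>2) * (1 - (cmod z)\<^sup>2) > 0"
    using assms by (intro mult_pos_pos) (simp_all add: power_less_one_iff)
  ultimately have "cmod (a - z) < cmod (1 - cnj a * z)"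
    by (intro power2_less_imp_less[of "cmod (a - z)"]) simp_all
  then show ?thesis
    using disk_aut_denom_nonzero[OF assms] by (simp add: disk_aut_def norm_divide)
qed

section \<open>The fibres of a Blaschke product of order two\<close>

text \<open>
  For \<open>\<psi> = c \<phi>\<^sub>a \<phi>\<^sub>b\<close> this is the second solution of \<open>\<psi> z = \<psi> 0\<close> in the disk, counted with
  multiplicity. The disk automorphism \<open>\<phi>\<^sub>d\<close> with this \<open>d\<close> exchanges the two points of every fibre of
  \<open>\<psi>\<close>. It is \<open>z \<mapsto> - z\<close> exactly if \<open>d = 0\<close>.
\<close>
definition swap_point :: "complex \<Rightarrow> complex \<Rightarrow> complex" where
  "swap_point a b = (a + b - a * b * (cnj a + cnj b)) / (1 - a * b * (cnj a * cnj b))"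

lemma one_minus_norm_prod_nonzero:
  assumes "cmod a < 1" "cmod b < 1"
  shows "1 - a * b * (cnj a * cnj b) \<noteq> 0"
proof -
  have "cmod (a * b) < 1" using assms mult_strict_mono[of "cmod a" 1 "cmod b" 1] by (simp add: norm_mult)
  then show ?thesis using disk_aut_denom_nonzero[of "a * b" "a * b"] by (simp add: mult.commute)
qed

text \<open>
  With \<open>x = \<bar>a\<bar>\<close> and \<open>y = \<bar>b\<bar>\<close> the numerator is at most \<open>(x + y) (1 - x y)\<close>, the denominator is
  \<open>(1 + x y) (1 - x y)\<close>, and \<open>x + y < 1 + x y\<close>.
\<close>
lemma cmod_swap_point_less_1:
  assumes "cmod a < 1" "cmod b < 1"
  shows "cmod (swap_point a b) < 1"
proof -
  define x y where "x = cmod a" and "y = cmod b"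
  have xy: "0 \<le> x" "x < 1" "0 \<le> y" "y < 1" using assms by (auto simp: x_def y_def)
  have num: "a + b - a * b * (cnj a + cnj b) = a * of_real (1 - y\<^sup>2) + b * of_real (1 - x\<^sup>2)"
    unfolding x_def y_def of_real_diff complex_norm_square of_real_1 by (simp add: algebra_simps)
  have den: "1 - a * b * (cnj a * cnj b) = of_real (1 - x\<^sup>2 * y\<^sup>2)"
    unfolding x_def y_def of_real_diff of_real_mult complex_norm_square of_real_1 by (simp add: algebra_simps)
  have "x * y < 1" using xy mult_strict_mono[of x 1 y 1] by simp
  have "cmod (a + b - a * b * (cnj a + cnj b)) \<le> x * (1 - y\<^sup>2) + y * (1 - x\<^sup>2)"
  proof -
    have "x\<^sup>2 \<le> 1" "y\<^sup>2 \<le> 1" using xy by (simp_all add: power_le_one)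
    then show ?thesis
      unfolding num using norm_triangle_ineq[of "a * of_real (1 - y\<^sup>2)" "b * of_real (1 - x\<^sup>2)"]
      by (simp add: norm_mult x_def y_def del: of_real_diff of_real_power)
  qed
  also have "\<dots> = (1 - x * y) * (x + y)" by (simp add: algebra_simps power2_eq_square)
  also have "\<dots> < (1 - x * y) * (1 + x * y)"
  proof (rule mult_strict_left_mono)
    have "(1 - x) * (1 - y) > 0" using xy by simp
    then show "x + y < 1 + x * y" by (simp add: algebra_simps)
  qed (use \<open>x * y < 1\<close> in simp)
  also have "\<dots> = 1 - x\<^sup>2 * y\<^sup>2" by (simp add: algebra_simps power2_eq_square)
  finally have "cmod (a + b - a * b * (cnj a + cnj b)) < 1 - x\<^sup>2 * y\<^sup>2" .
  moreover have "1 - x\<^sup>2 * y\<^sup>2 > 0" using calculation by (meson norm_ge_zero le_less_trans)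
  ultimately show ?thesis
    unfolding swap_point_def den norm_divide norm_of_real by simp
qed

text \<open>
  The two points over \<open>v\<close> are the roots of the quadratic polynomial
  \<open>(a - x) (b - x) - v (1 - cnj a * x) (1 - cnj b * x)\<close>. The first two equations are Vieta's formulas for
  \<open>z\<close> and \<open>\<tau>\<close>; the third says that the degree does not drop.
\<close>
lemma blaschke2_fibre:
  assumes a: "cmod a < 1" and b: "cmod b < 1" and z: "cmod z < 1"
  defines "\<tau> \<equiv> disk_aut (swap_point a b) z" and "v \<equiv> disk_aut a z * disk_aut b z"
  shows "(1 - v * (cnj a * cnj b)) * (z + \<tau>) = a + b - v * (cnj a + cnj b)"
    and "(1 - v * (cnj a * cnj b)) * (z * \<tau>) = a * b - v"
    and "1 - v * (cnj a * cnj b) \<noteq> 0"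
proof -
  define m n s t where "m = a * b" and "n = cnj a * cnj b" and "s = a + b" and "t = cnj a + cnj b"
  define q where "q = (1 - cnj a * z) * (1 - cnj b * z)"
  have q: "q \<noteq> 0" using disk_aut_denom_nonzero a b z by (simp add: q_def)
  have mn: "1 - m * n \<noteq> 0" using one_minus_norm_prod_nonzero[OF a b] by (simp add: m_def n_def)
  have d: "swap_point a b = (s - m * t) / (1 - m * n)"
    by (simp add: swap_point_def m_def n_def s_def t_def)
  have cd: "cnj (swap_point a b) = (t - n * s) / (1 - m * n)"
    by (simp add: swap_point_def m_def n_def s_def t_def mult.commute)
  define D where "D = 1 - m * n - (t - n * s) * z"
  define N where "N = s - m * t - (1 - m * n) * z"
  have "1 - cnj (swap_point a b) * z \<noteq> 0"
    by (rule disk_aut_denom_nonzero[OF cmod_swap_point_less_1[OF a b] z])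
  then have D: "D \<noteq> 0" using mn by (simp add: cd D_def field_simps)
  have tau: "\<tau> = N / D"
  proof -
    have "(s - m * t) / (1 - m * n) - z = N / (1 - m * n)"
      and "1 - (t - n * s) / (1 - m * n) * z = D / (1 - m * n)"
      using mn by (simp_all add: N_def D_def field_simps)
    then have "\<tau> = (N / (1 - m * n)) / (D / (1 - m * n))"
      unfolding \<tau>_def disk_aut_def cd unfolding d by simp
    then show ?thesis using mn by simp
  qed
  have v: "v = (m - s * z + z\<^sup>2) / q"
    by (simp add: v_def disk_aut_def q_def m_def s_def algebra_simps power2_eq_square)
  have qe: "q = 1 - t * z + n * z\<^sup>2"
    by (simp add: q_def t_def n_def algebra_simps power2_eq_square)
  have K: "1 - v * n = D / q"
  proof -
    have "D = q - (m - s * z + z\<^sup>2) * n" by (simp add: D_def qe algebra_simps)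
    then show ?thesis using q by (simp add: v diff_divide_distrib)
  qed
  then show "1 - v * (cnj a * cnj b) \<noteq> 0" using D q by (simp add: n_def)
  have "(1 - v * n) * (z + \<tau>) = (D * z + N) / q" unfolding K tau using D by (simp add: add_divide_distrib distrib_left)
  also have "D * z + N = s * q - (m - s * z + z\<^sup>2) * t"
    by (simp add: D_def N_def qe algebra_simps power2_eq_square)
  also have "\<dots> / q = s - v * t" using q by (simp add: v diff_divide_distrib)
  finally show "(1 - v * (cnj a * cnj b)) * (z + \<tau>) = a + b - v * (cnj a + cnj b)"
    by (simp add: n_def s_def t_def)
  have "(1 - v * n) * (z * \<tau>) = (z * N) / q" unfolding K tau using D by simp
  also have "z * N = m * q - (m - s * z + z\<^sup>2)"
    by (simp add: N_def qe algebra_simps power2_eq_square)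
  also have "\<dots> / q = m - v" using q by (simp add: v diff_divide_distrib)
  finally show "(1 - v * (cnj a * cnj b)) * (z * \<tau>) = a * b - v" by (simp add: n_def m_def)
qed

text \<open>
  By Vieta's formulas \<open>\<tau>\<close> is a root of the quadratic polynomial whose roots are the points over
  the value at \<open>z\<close>.
\<close>
lemma blaschke2_swap:
  assumes a: "cmod a < 1" and b: "cmod b < 1" and z: "cmod z < 1"
  defines "\<tau> \<equiv> disk_aut (swap_point a b) z"
  shows "disk_aut a \<tau> * disk_aut b \<tau> = disk_aut a z * disk_aut b z"
proof -
  have tau: "cmod \<tau> < 1"
    unfolding \<tau>_def by (intro cmod_disk_aut_less_1 cmod_swap_point_less_1 a b z)
  define v where "v = disk_aut a z * disk_aut b z"
  define k where "k = 1 - v * (cnj a * cnj b)"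
  note f = blaschke2_fibre(1,2)[OF a b z, folded \<tau>_def v_def k_def]
  have q: "1 - cnj a * \<tau> \<noteq> 0" "1 - cnj b * \<tau> \<noteq> 0"
    using disk_aut_denom_nonzero a b tau by auto
  have "(a - \<tau>) * (b - \<tau>) - v * ((1 - cnj a * \<tau>) * (1 - cnj b * \<tau>))
      = (a * b - v) - \<tau> * (a + b - v * (cnj a + cnj b)) + k * \<tau>\<^sup>2"
    by (simp add: k_def algebra_simps power2_eq_square)
  also have "\<dots> = 0" unfolding f[symmetric] by (simp add: k_def algebra_simps power2_eq_square)
  finally have eq: "(a - \<tau>) * (b - \<tau>) = v * ((1 - cnj a * \<tau>) * (1 - cnj b * \<tau>))" by simp
  have "disk_aut a \<tau> * disk_aut b \<tau> = v"
    unfolding disk_aut_def times_divide_times_eq eq using q by simp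
  then show ?thesis by (simp add: v_def)
qed

text \<open>
  The function \<open>R = 1 - cnj w * \<Psi>\<close> is rational. It vanishes at the reflections \<open>1 / cnj z\<close> and
  \<open>1 / cnj \<tau>\<close> of the points over \<open>w\<close> and has its poles at the reflections of the zeros \<open>a\<close> and \<open>b\<close>, so
  its logarithmic derivative is \<open>- L\<close>. The claim is the equation \<open>R' = - R L\<close>, solved for \<open>L\<close>.
\<close>
lemma blaschke2_log_deriv:
  assumes c: "cmod c = 1" and a: "cmod a < 1" and b: "cmod b < 1" and z: "cmod z < 1"
  defines "\<tau> \<equiv> disk_aut (swap_point a b) z" and "w \<equiv> c * (disk_aut a z * disk_aut b z)"
    and "\<Psi> \<equiv> blaschke2 c a b"
  defines "L \<equiv> fps_const (cnj z) * geometric (cnj z) + fps_const (cnj \<tau>) * geometric (cnj \<tau>)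
    - fps_const (cnj a) * geometric (cnj a) - fps_const (cnj b) * geometric (cnj b)"
  shows "L = fps_const (cnj w) * fps_deriv \<Psi> + fps_const (cnj w) * (\<Psi> * L)"
proof -
  define v where "v = disk_aut a z * disk_aut b z"
  define k where "k = 1 - cnj v * (a * b)"
  define lin where "lin u = 1 - fps_const (cnj u) * fps_X" for u
  have lin: "lin u * geometric (cnj u) = 1" for u unfolding lin_def by (rule geometric_inverse)
  define R where "R = fps_const k * (lin z * lin \<tau> * (geometric (cnj a) * geometric (cnj b)))"
  have sum: "k * (cnj z + cnj \<tau>) = cnj a + cnj b - cnj v * (a + b)"
    and prod: "k * (cnj z * cnj \<tau>) = cnj a * cnj b - cnj v"
    using blaschke2_fibre(1,2)[OF a b z, folded \<tau>_def v_def, THEN arg_cong[of _ _ cnj]]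
    unfolding complex_cnj_mult complex_cnj_add complex_cnj_diff complex_cnj_cnj complex_cnj_one k_def
    by (simp_all only:)
  have poly: "fps_const k * (lin z * lin \<tau>) =
      lin a * lin b - fps_const (cnj v) * ((fps_const a - fps_X) * (fps_const b - fps_X))"
  proof -
    have "fps_const k * (lin z * lin \<tau>) = fps_const k - fps_const (k * (cnj z + cnj \<tau>)) * fps_X
        + fps_const (k * (cnj z * cnj \<tau>)) * fps_X ^ 2"
      by (simp add: lin_def algebra_simps power2_eq_square flip: fps_const_mult fps_const_add)
    also have "\<dots> = lin a * lin b - fps_const (cnj v) * ((fps_const a - fps_X) * (fps_const b - fps_X))"
      unfolding sum prod unfolding k_def
      by (simp add: lin_def algebra_simps power2_eq_square
        flip: fps_const_mult fps_const_add fps_const_sub fps_const_1_eq_1)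
    finally show ?thesis .
  qed
  have cc: "cnj w * c = cnj v"
    using c complex_norm_square[of c] by (simp add: w_def v_def mult_ac)
  have R: "R = 1 - fps_const (cnj w) * \<Psi>"
  proof -
    have "R = (fps_const k * (lin z * lin \<tau>)) * (geometric (cnj a) * geometric (cnj b))"
      by (simp add: R_def mult_ac)
    also have "\<dots> = (lin a * geometric (cnj a)) * (lin b * geometric (cnj b)) - fps_const (cnj v) * (blaschke_factor a * blaschke_factor b)"
      unfolding poly by (simp add: blaschke_factor_def algebra_simps flip: fps_const_mult)
    also have "\<dots> = 1 - fps_const (cnj w) * \<Psi>"
      by (simp add: lin \<Psi>_def blaschke2_def mult.assoc[symmetric] cc)
    finally show ?thesis .
  qed
  have "fps_deriv R = - (R * L)"
  proof -
    have dlin: "fps_deriv (lin u) = - fps_const (cnj u)" for u by (simp add: lin_def)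
    have glin: "fps_const (cnj u) = fps_const (cnj u) * (lin u * geometric (cnj u))" for u by (simp add: lin)
    have "fps_deriv R = fps_const k * (
        - (fps_const (cnj z) * (lin z * geometric (cnj z))) * lin \<tau> * (geometric (cnj a) * geometric (cnj b))
        - lin z * (fps_const (cnj \<tau>) * (lin \<tau> * geometric (cnj \<tau>))) * (geometric (cnj a) * geometric (cnj b))
        + lin z * lin \<tau> * (fps_const (cnj a) * geometric (cnj a) * geometric (cnj a) * geometric (cnj b)
          + geometric (cnj a) * (fps_const (cnj b) * geometric (cnj b) * geometric (cnj b))))"
      unfolding glin[symmetric] by (simp add: R_def dlin geometric_deriv algebra_simps flip: fps_const_neg)
    also have "\<dots> = - (R * L)" by (simp add: R_def L_def algebra_simps)
    finally show ?thesis .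
  qed
  moreover have "fps_deriv R = - (fps_const (cnj w) * fps_deriv \<Psi>)" by (simp add: R)
  ultimately have "R * L = fps_const (cnj w) * fps_deriv \<Psi>" by simp
  then show ?thesis unfolding R by (simp add: algebra_simps)
qed

text \<open>
  Iterating \<open>L = cnj w * \<Psi>' + cnj w * \<Psi> L\<close> expands \<open>L\<close> in the series
  \<open>\<Sum>k. (cnj w)\<^sup>k\<^sup>+\<^sup>1 \<Psi>' \<Psi>\<^sup>k\<close>; the remainder tends to zero because \<open>\<Psi>\<close> is isometric and \<open>\<bar>w\<bar> < 1\<close>. So
  \<open>\<Psi> U\<close> is orthogonal to \<open>L\<close>. As \<open>L\<close> is a combination of Szego kernels, this is a relation between the
  values of \<open>x \<mapsto> x (\<Psi> U) x\<close> at \<open>z\<close>, \<open>\<tau>\<close>, \<open>a\<close> and \<open>b\<close>. The last two are zero since \<open>\<Psi>\<close> vanishes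
  at \<open>a\<close> and \<open>b\<close>, and at \<open>z\<close> and \<open>\<tau>\<close> the common nonzero value \<open>w\<close> of \<open>\<Psi>\<close> cancels.
\<close>
lemma blaschke2_trace_eq_zero:
  assumes c: "cmod c = 1" and a: "cmod a < 1" and b: "cmod b < 1" and z: "cmod z < 1"
  defines "\<tau> \<equiv> disk_aut (swap_point a b) z" and "\<Psi> \<equiv> blaschke2 c a b"
  assumes U: "U \<in> H2" and orth: "\<And>k. H2_inner (fps_deriv \<Psi> * \<Psi> ^ k) (\<Psi> * U) = 0"
    and z0: "disk_aut a z * disk_aut b z \<noteq> 0"
  shows "z * eval_fps U z + \<tau> * eval_fps U \<tau> = 0"
proof -
  define w where "w = c * (disk_aut a z * disk_aut b z)"
  have tau: "cmod \<tau> < 1"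
    unfolding \<tau>_def by (intro cmod_disk_aut_less_1 cmod_swap_point_less_1 a b z)
  have w: "cmod w < 1"
    using c mult_strict_mono[OF cmod_disk_aut_less_1[OF a z] cmod_disk_aut_less_1[OF b z]]
    by (simp add: w_def norm_mult)
  define L where "L = fps_const (cnj z) * geometric (cnj z) + fps_const (cnj \<tau>) * geometric (cnj \<tau>)
    - fps_const (cnj a) * geometric (cnj a) - fps_const (cnj b) * geometric (cnj b)"
  have iso: "H2_isometric \<Psi>" unfolding \<Psi>_def using c a b by (rule H2_isometric_blaschke2)
  note [simp] = H2_isometric_multiplier[OF iso] U
    H2_multiplier_deriv_blaschke2[OF a b, of c, folded \<Psi>_def]
  have L [simp]: "L \<in> H2" using a b z tau by (simp add: L_def)
  have Leq: "L = fps_const (cnj w) * fps_deriv \<Psi> + fps_const (cnj w) * (\<Psi> * L)"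
    unfolding L_def w_def \<tau>_def \<Psi>_def by (rule blaschke2_log_deriv[OF c a b z])
  have in_H2: "fps_deriv \<Psi> * \<Psi> ^ k \<in> H2" for k
    by (intro H2_multiplier_in_H2) simp
  have unroll: "H2_inner L (\<Psi> * U) = cnj w ^ n * H2_inner (\<Psi> ^ n * L) (\<Psi> * U)" for n
  proof (induction n)
    case (Suc n)
    have "\<Psi> ^ n * L = \<Psi> ^ n * (fps_const (cnj w) * fps_deriv \<Psi> + fps_const (cnj w) * (\<Psi> * L))"
      using Leq by simp
    also have "\<dots> = fps_const (cnj w) * (fps_deriv \<Psi> * \<Psi> ^ n) + fps_const (cnj w) * (\<Psi> ^ Suc n * L)"
      by (simp add: algebra_simps)
    finally have "H2_inner (\<Psi> ^ n * L) (\<Psi> * U) = cnj w * H2_inner (\<Psi> ^ Suc n * L) (\<Psi> * U)"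
      using in_H2[of n] orth[of n] by (simp del: power_Suc)
    then show ?case using Suc by simp
  qed simp
  have bound: "cmod (H2_inner (\<Psi> ^ n * L) (\<Psi> * U)) \<le> sqrt ((1 + H2_norm_sq (\<Psi> * U)) * H2_norm_sq L)" for n
  proof (rule real_le_rsqrt)
    have "(cmod (H2_inner (\<Psi> ^ n * L) (\<Psi> * U)))\<^sup>2 \<le> (1 + H2_norm_sq (\<Psi> * U)) * (H2_norm_sq (\<Psi> ^ n * L) - 0)"
      by (intro H2_inner_le_excess) simp_all
    moreover have "complex_of_real (H2_norm_sq (\<Psi> ^ n * L)) = of_real (H2_norm_sq L)"
      using H2_isometric_inner[OF H2_isometric_power[OF iso], of L L n] by (simp flip: H2_inner_self)
    ultimately show "(cmod (H2_inner (\<Psi> ^ n * L) (\<Psi> * U)))\<^sup>2 \<le> (1 + H2_norm_sq (\<Psi> * U)) * H2_norm_sq L"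
      by (simp del: of_real_power)
  qed
  have "(\<lambda>n. cnj w ^ n * H2_inner (\<Psi> ^ n * L) (\<Psi> * U)) \<longlonglongrightarrow> 0"
  proof (rule Lim_null_comparison)
    show "(\<lambda>n. cmod w ^ n * sqrt ((1 + H2_norm_sq (\<Psi> * U)) * H2_norm_sq L)) \<longlonglongrightarrow> 0"
      using w by (intro tendsto_mult_left_zero LIMSEQ_power_zero) simp
    show "\<forall>\<^sub>F n in sequentially. norm (cnj w ^ n * H2_inner (\<Psi> ^ n * L) (\<Psi> * U))
        \<le> cmod w ^ n * sqrt ((1 + H2_norm_sq (\<Psi> * U)) * H2_norm_sq L)"
      using bound by (intro always_eventually allI) (simp add: norm_mult norm_power mult_left_mono)
  qed
  then have zero: "H2_inner L (\<Psi> * U) = 0"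
    unfolding unroll[symmetric] by (simp add: LIMSEQ_const_iff)
  have ker: "H2_inner (geometric (cnj x)) (\<Psi> * U) = cnj (c * (disk_aut a x * disk_aut b x) * eval_fps U x)"
    if "cmod x < 1" for x
  proof -
    have "H2_inner (geometric (cnj x)) (\<Psi> * U) = cnj (eval_fps (\<Psi> * U) x)"
      using H2_inner_commute[of "\<Psi> * U" "geometric (cnj x)"] that by (simp add: H2_inner_geometric)
    also have "eval_fps (\<Psi> * U) x = eval_fps \<Psi> x * eval_fps U x"
      using that by (intro H2_eval_mult) (simp_all add: H2_multiplier_in_H2)
    finally show ?thesis using that c a b by (simp add: \<Psi>_def eval_blaschke2)
  qed
  have fib: "disk_aut a \<tau> * disk_aut b \<tau> = disk_aut a z * disk_aut b z"
    unfolding \<tau>_def by (rule blaschke2_swap[OF a b z])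
  have "H2_inner L (\<Psi> * U) = cnj (z * (w * eval_fps U z) + \<tau> * (w * eval_fps U \<tau>))"
    using a b z tau by (simp add: L_def ker fib) (simp add: w_def disk_aut_def)
  then have "z * (w * eval_fps U z) + \<tau> * (w * eval_fps U \<tau>) = 0"
    unfolding zero by (metis complex_cnj_zero_iff)
  then have "w * (z * eval_fps U z + \<tau> * eval_fps U \<tau>) = 0"
    by (simp add: algebra_simps)
  moreover have "w \<noteq> 0" using c z0 by (auto simp: w_def)
  ultimately show ?thesis by simp
qed

section \<open>Elements of the space as power series\<close>

definition S2_fps :: "complex fps set" where
  "S2_fps = {F. fps_deriv F \<in> H2}"

lemma S2_fps_deriv [simp]: "F \<in> S2_fps \<Longrightarrow> fps_deriv F \<in> H2"
  by (simp add: S2_fps_def)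

lemma S2_fps_in_H2 [simp]: "F \<in> S2_fps \<Longrightarrow> F \<in> H2"
  by (simp add: H2_of_deriv)

lemma S2_fps_0 [simp]: "0 \<in> S2_fps"
  by (simp add: S2_fps_def del: S2_fps_in_H2 S2_fps_deriv)

lemma S2_fps_1 [simp]: "1 \<in> S2_fps"
  by (simp add: S2_fps_def del: S2_fps_in_H2 S2_fps_deriv)

lemma S2_fps_add [simp]: "F \<in> S2_fps \<Longrightarrow> G \<in> S2_fps \<Longrightarrow> F + G \<in> S2_fps"
  by (simp add: S2_fps_def del: S2_fps_in_H2 S2_fps_deriv)

lemma S2_fps_diff [simp]: "F \<in> S2_fps \<Longrightarrow> G \<in> S2_fps \<Longrightarrow> F - G \<in> S2_fps"
  by (simp add: S2_fps_def del: S2_fps_in_H2 S2_fps_deriv)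

lemma S2_fps_scale [simp]: "F \<in> S2_fps \<Longrightarrow> fps_const c * F \<in> S2_fps"
  by (simp add: S2_fps_def del: S2_fps_in_H2 S2_fps_deriv)

lemma S2_fps_mult:
  assumes "H2_multiplier \<Psi>" "H2_multiplier (fps_deriv \<Psi>)" "F \<in> S2_fps"
  shows "\<Psi> * F \<in> S2_fps"
proof -
  have "fps_deriv (\<Psi> * F) \<in> H2" using assms by simp
  then show ?thesis by (simp add: S2_fps_def del: S2_fps_in_H2 S2_fps_deriv)
qed

lemma S2_fps_power_mult: "H2_multiplier \<Psi> \<Longrightarrow> H2_multiplier (fps_deriv \<Psi>) \<Longrightarrow> F \<in> S2_fps \<Longrightarrow> \<Psi> ^ n * F \<in> S2_fps"
  by (induction n) (simp_all add: S2_fps_mult mult.assoc)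

lemma S2_fps_X_power [simp]: "fps_X ^ n \<in> S2_fps"
  using S2_fps_power_mult[of fps_X 1 n] by simp

lemma S2_fps_inner_commute: "F \<in> S2_fps \<Longrightarrow> G \<in> S2_fps \<Longrightarrow> S2_fps_inner G F = cnj (S2_fps_inner F G)"
  by (simp add: S2_fps_inner_def H2_inner_commute[of "fps_deriv F" "fps_deriv G"] mult.commute)

lemma S2_fps_inner_diff_left: "F \<in> S2_fps \<Longrightarrow> F' \<in> S2_fps \<Longrightarrow> G \<in> S2_fps \<Longrightarrow> S2_fps_inner (F - F') G = S2_fps_inner F G - S2_fps_inner F' G"
  by (simp add: S2_fps_inner_def algebra_simps)

lemma S2_fps_inner_1_left: "S2_fps_inner 1 F = cnj (F $ 0)"
  by (simp add: S2_fps_inner_def H2_inner_def)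

text \<open>
  The inverse of taking the Taylor series at \<open>0\<close>, with the value \<open>0\<close> off the disk by which the
  elements of \<open>S2\<close> are normalized.
\<close>
definition S2_fun :: "complex fps \<Rightarrow> complex \<Rightarrow> complex" where
  "S2_fun F = (\<lambda>z. if z \<in> ball 0 1 then eval_fps F z else 0)"

lemma S2_fun_holomorphic: "F \<in> H2 \<Longrightarrow> eval_fps F holomorphic_on ball 0 1"
  by (intro holomorphic_on_eval_fps) (auto simp: H2_in_conv_radius)

lemma S2_fun_expansion:
  assumes "F \<in> H2"
  shows "fps_expansion (S2_fun F) 0 = F"
proof (rule fps_expansion_eqI)
  have "fps_conv_radius F > 0"
    using H2_in_conv_radius[OF assms, of 0] by (simp add: zero_ereal_def)
  moreover have "\<forall>\<^sub>F z in nhds 0. eval_fps F z = S2_fun F z"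
    using eventually_nhds_in_open[of "ball 0 1" "0::complex"] by (auto elim!: eventually_mono simp: S2_fun_def)
  ultimately show "S2_fun F has_fps_expansion F"
    unfolding has_fps_expansion_def by simp
qed

lemma taylor_coeff_S2_fun: "F \<in> H2 \<Longrightarrow> taylor_coeff (S2_fun F) n = F $ n"
  using arg_cong[OF S2_fun_expansion, of F "\<lambda>F. F $ n"] by (simp add: taylor_coeff_def fps_expansion_def)

lemma summable_shift_deriv:
  "summable (\<lambda>n. (real n)\<^sup>2 * (cmod (F $ n))\<^sup>2) \<longleftrightarrow> fps_deriv F \<in> H2"
proof -
  have eq: "(real (Suc n))\<^sup>2 * (cmod (F $ Suc n))\<^sup>2 = (cmod (fps_deriv F $ n))\<^sup>2" for n
    unfolding fps_deriv_nth Suc_eq_plus1[symmetric] norm_mult norm_of_nat power_mult_distrib ..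
  show ?thesis
    using summable_Suc_iff[of "\<lambda>n. (real n)\<^sup>2 * (cmod (F $ n))\<^sup>2"] unfolding eq H2_def by simp
qed

lemma S2_fun_in_S2: "F \<in> S2_fps \<Longrightarrow> S2_fun F \<in> S2"
proof -
  assume F: "F \<in> S2_fps"
  have "S2_fun F holomorphic_on ball 0 1"
    using S2_fun_holomorphic[of F] F
    by (subst holomorphic_cong[of _ "ball 0 1" _ "eval_fps F"]) (auto simp: S2_fun_def)
  moreover have "\<And>z. z \<notin> ball 0 1 \<Longrightarrow> S2_fun F z = 0" by (auto simp: S2_fun_def)
  ultimately show ?thesis
    using F by (simp add: S2_def taylor_coeff_S2_fun summable_shift_deriv)
qed

lemma S2_eq: "S2 = S2_fun ` S2_fps"
proof
  show "S2_fun ` S2_fps \<subseteq> S2" using S2_fun_in_S2 by auto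
  show "S2 \<subseteq> S2_fun ` S2_fps"
  proof
    fix f assume f: "f \<in> S2"
    define F where "F = fps_expansion f 0"
    have hol: "f holomorphic_on eball 0 (ereal 1)" and off: "\<And>z. z \<notin> ball 0 1 \<Longrightarrow> f z = 0"
      and sum: "summable (\<lambda>n. (real n)\<^sup>2 * (cmod (taylor_coeff f n))\<^sup>2)"
      using f by (auto simp: S2_def)
    have "taylor_coeff f = fps_nth F"
      by (simp add: taylor_coeff_def F_def fps_expansion_def fun_eq_iff)
    then have "F \<in> S2_fps" using sum by (simp add: summable_shift_deriv S2_fps_def del: S2_fps_in_H2 S2_fps_deriv)
    moreover have "f = S2_fun F"
    proof
      fix z show "f z = S2_fun F z"
        using eval_fps_expansion'[OF hol, of z] off[of z] by (auto simp: S2_fun_def F_def)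
    qed
    ultimately show "f \<in> S2_fun ` S2_fps" by blast
  qed
qed

lemma S2E:
  assumes "f \<in> S2"
  obtains F where "F \<in> S2_fps" "f = S2_fun F"
  using assms unfolding S2_eq by blast

lemma S2_fun_inject: "F \<in> S2_fps \<Longrightarrow> G \<in> S2_fps \<Longrightarrow> S2_fun F = S2_fun G \<longleftrightarrow> F = G"
  by (metis S2_fun_expansion S2_fps_in_H2)

lemma S2_fun_0: "S2_fun 0 = (\<lambda>z. 0)"
  by (auto simp: S2_fun_def)

lemma S2_fun_add: "F \<in> S2_fps \<Longrightarrow> G \<in> S2_fps \<Longrightarrow> (\<lambda>z. S2_fun F z + S2_fun G z) = S2_fun (F + G)"
  by (auto simp: S2_fun_def eval_fps_add H2_in_conv_radius)

lemma S2_fun_diff: "F \<in> S2_fps \<Longrightarrow> G \<in> S2_fps \<Longrightarrow> (\<lambda>z. S2_fun F z - S2_fun G z) = S2_fun (F - G)"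
  by (auto simp: S2_fun_def eval_fps_diff H2_in_conv_radius)

lemma S2_fun_scale: "F \<in> S2_fps \<Longrightarrow> (\<lambda>z. c * S2_fun F z) = S2_fun (fps_const c * F)"
  by (auto simp: S2_fun_def eval_fps_mult H2_in_conv_radius)

lemma mult_op_S2_fun:
  assumes "\<And>z. z \<in> ball 0 1 \<Longrightarrow> \<psi> z = eval_fps \<Psi> z" "\<Psi> \<in> H2" "F \<in> S2_fps"
  shows "mult_op \<psi> (S2_fun F) = S2_fun (\<Psi> * F)"
  using assms by (auto simp: mult_op_def S2_fun_def H2_eval_mult)

lemma S2_inner_S2_fun:
  assumes "F \<in> S2_fps" "G \<in> S2_fps"
  shows "S2_inner (S2_fun F) (S2_fun G) = S2_fps_inner F G"
proof -
  define u where "u n = (of_nat n)\<^sup>2 * F $ n * cnj (G $ n)" for n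
  have eq: "u (Suc n) = fps_deriv F $ n * cnj (fps_deriv G $ n)" for n
    unfolding fps_deriv_nth u_def Suc_eq_plus1[symmetric] by (simp add: power2_eq_square mult_ac del: of_nat_Suc)
  have "summable (\<lambda>n. u (Suc n))"
    unfolding eq using assms by (intro H2_inner_summable) auto
  then have "suminf u = (\<Sum>n. u (Suc n)) + u 0"
    using suminf_split_head[of u] by (simp add: summable_Suc_iff[of u])
  then have "suminf u = H2_inner (fps_deriv F) (fps_deriv G)"
    unfolding eq H2_inner_def by (simp add: u_def)
  then show ?thesis
    using assms by (simp add: S2_inner_def S2_fps_inner_def taylor_coeff_S2_fun u_def[abs_def])
qed

lemma S2_norm_S2_fun:
  assumes "F \<in> S2_fps"
  shows "S2_norm (S2_fun F) = sqrt ((cmod (F $ 0))\<^sup>2 + H2_norm_sq (fps_deriv F))"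
proof -
  define u where "u n = (real n)\<^sup>2 * (cmod (F $ n))\<^sup>2" for n
  have eq: "u (Suc n) = (cmod (fps_deriv F $ n))\<^sup>2" for n
    unfolding u_def fps_deriv_nth Suc_eq_plus1[symmetric] norm_mult norm_of_nat power_mult_distrib ..
  have "summable (\<lambda>n. u (Suc n))"
    unfolding eq using assms by (simp add: S2_fps_def H2_def del: S2_fps_in_H2 S2_fps_deriv)
  then have "suminf u = (\<Sum>n. u (Suc n)) + u 0"
    using suminf_split_head[of u] by (simp add: summable_Suc_iff[of u])
  then have "suminf u = H2_norm_sq (fps_deriv F)"
    unfolding eq H2_norm_sq_def by (simp add: u_def)
  then show ?thesis
    using assms by (simp add: S2_norm_def taylor_coeff_S2_fun u_def[abs_def])
qed

section \<open>Projection onto a closed subspace\<close>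

text \<open>
  The unitary map from \<open>S\<^sup>2\<close> onto the Hardy space that multiplies the coefficient of index \<open>n \<ge> 1\<close>
  by \<open>n\<close>. It carries the projection theorem over.
\<close>
definition weigh :: "complex fps \<Rightarrow> complex fps" where
  "weigh F = fps_const (F $ 0) + fps_X * fps_deriv F"

lemma weigh_nth: "weigh F $ n = (if n = 0 then F $ 0 else of_nat n * F $ n)"
  by (cases n) (simp_all add: weigh_def)

lemma weigh_in_H2_iff: "weigh F \<in> H2 \<longleftrightarrow> F \<in> S2_fps"
proof -
  have c: "fps_const (F $ 0) \<in> H2" using H2_const_mult[OF H2_one] by simp
  have "fps_X * fps_deriv F \<in> H2 \<longleftrightarrow> weigh F \<in> H2"
    using H2_add[OF c, of "fps_X * fps_deriv F"] H2_diff[OF _ c, of "weigh F"] by (auto simp: weigh_def)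
  then show ?thesis by (simp add: S2_fps_def del: S2_fps_in_H2 S2_fps_deriv)
qed

lemma weigh_add: "weigh (F + G) = weigh F + weigh G"
  by (simp add: weigh_def algebra_simps flip: fps_const_add)

lemma weigh_diff: "weigh (F - G) = weigh F - weigh G"
  by (simp add: weigh_def algebra_simps flip: fps_const_sub)

lemma weigh_scale: "weigh (fps_const c * F) = fps_const c * weigh F"
  by (simp add: weigh_def algebra_simps flip: fps_const_mult)

lemma weigh_surj: "\<exists>F. weigh F = G"
proof
  show "weigh (Abs_fps (\<lambda>n. if n = 0 then G $ 0 else G $ n / of_nat n)) = G"
    by (rule fps_ext) (simp add: weigh_nth)
qed

lemma H2_inner_weigh:
  assumes "F \<in> S2_fps" "G \<in> S2_fps"
  shows "H2_inner (weigh F) (weigh G) = S2_fps_inner F G"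
proof -
  have "summable (\<lambda>n. weigh F $ n * cnj (weigh G $ n))"
    using assms by (intro H2_inner_summable) (auto simp: weigh_in_H2_iff)
  from suminf_split_head[OF this] show ?thesis
    by (simp add: H2_inner_def S2_fps_inner_def weigh_def)
qed

lemma S2_norm_eq_weigh:
  assumes "F \<in> S2_fps"
  shows "S2_norm (S2_fun F) = sqrt (H2_norm_sq (weigh F))"
proof -
  have "complex_of_real (H2_norm_sq (weigh F)) = H2_inner (weigh F) (weigh F)"
    using assms by (simp add: H2_inner_self weigh_in_H2_iff)
  also have "\<dots> = of_real ((cmod (F $ 0))\<^sup>2 + H2_norm_sq (fps_deriv F))"
    using assms complex_norm_square[of "F $ 0"] by (simp add: H2_inner_weigh S2_fps_inner_def H2_inner_self)
  finally show ?thesis unfolding S2_norm_S2_fun[OF assms] of_real_eq_iff by simp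
qed

lemma S2_projection:
  assumes M: "S2_closed_subspace M" and H: "H \<in> S2_fps"
  obtains P where "P \<in> S2_fps" "S2_fun P \<in> M" "S2_fun (H - P) \<in> S2_orth M"
proof -
  define N where "N = {F \<in> S2_fps. S2_fun F \<in> M}"
  note sub = M[unfolded S2_closed_subspace_def]
  obtain Q where Q: "Q \<in> weigh ` N" "\<And>F. F \<in> weigh ` N \<Longrightarrow> H2_inner F (weigh H - Q) = 0"
  proof (rule H2_projection[of "weigh ` N" "weigh H"])
    show "weigh ` N \<subseteq> H2" by (auto simp: N_def weigh_in_H2_iff)
    have "0 \<in> N" using sub by (simp add: N_def S2_fun_0)
    moreover have "weigh 0 = 0" by (simp add: weigh_def)
    ultimately show "0 \<in> weigh ` N" by (metis imageI)
    show "F + G \<in> weigh ` N" if "F \<in> weigh ` N" "G \<in> weigh ` N" for F G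
    proof -
      from that obtain F' G' where F': "F' \<in> N" "F = weigh F'" and G': "G' \<in> N" "G = weigh G'" by blast
      have "(\<lambda>z. S2_fun F' z + S2_fun G' z) \<in> M" using F' G' sub by (simp add: N_def)
      then have "F' + G' \<in> N" using F' G' by (simp add: N_def S2_fun_add)
      then show ?thesis unfolding F'(2) G'(2) weigh_add[symmetric] by (rule imageI)
    qed
    show "fps_const c * F \<in> weigh ` N" if "F \<in> weigh ` N" for c F
    proof -
      from that obtain F' where F': "F' \<in> N" "F = weigh F'" by blast
      have "(\<lambda>z. c * S2_fun F' z) \<in> M" using F' sub by (simp add: N_def)
      then have "fps_const c * F' \<in> N" using F' by (simp add: N_def S2_fun_scale)
      then show ?thesis unfolding F'(2) weigh_scale[symmetric] by (rule imageI)
    qed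
    show "L \<in> weigh ` N" if F: "\<And>k::nat. F k \<in> weigh ` N" and L: "L \<in> H2"
      and lim: "(\<lambda>k. H2_norm_sq (F k - L)) \<longlonglongrightarrow> 0" for F L
    proof -
      have "\<forall>k. \<exists>G. G \<in> N \<and> F k = weigh G" using F by blast
      then obtain G where G: "\<And>k. G k \<in> N" "\<And>k. F k = weigh (G k)" by metis
      obtain L' where L': "L = weigh L'" using weigh_surj by metis
      have D: "L' \<in> S2_fps" "\<And>k. G k \<in> S2_fps" using L G by (auto simp: L' weigh_in_H2_iff N_def)
      have "S2_norm (\<lambda>z. S2_fun (G k) z - S2_fun L' z) = sqrt (H2_norm_sq (F k - L))" for k
        using D by (simp add: S2_fun_diff S2_norm_eq_weigh weigh_diff G(2) L')
      moreover have "(\<lambda>k. sqrt (H2_norm_sq (F k - L))) \<longlonglongrightarrow> 0"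
        using tendsto_real_sqrt[OF lim] by simp
      ultimately have "(\<lambda>k. S2_norm (\<lambda>z. S2_fun (G k) z - S2_fun L' z)) \<longlonglongrightarrow> 0" by simp
      moreover have "S2_fun L' \<in> S2" "\<forall>k. S2_fun (G k) \<in> M"
        using D G by (auto simp: S2_fun_in_S2 N_def)
      ultimately have "S2_fun L' \<in> M" using sub by meson
      then have "L' \<in> N" using D by (simp add: N_def)
      then show ?thesis unfolding L' by (rule imageI)
    qed
    show "weigh H \<in> H2" using H by (simp add: weigh_in_H2_iff)
  qed blast
  then obtain P where P: "P \<in> N" "Q = weigh P" by blast
  show ?thesis
  proof (rule that)
    show PD: "P \<in> S2_fps" and "S2_fun P \<in> M" using P by (auto simp: N_def)
    have "S2_inner f (S2_fun (H - P)) = 0" if "f \<in> M" for f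
    proof -
      have "f \<in> S2" using that sub by blast
      then obtain F where F: "F \<in> S2_fps" "f = S2_fun F" by (rule S2E)
      have "H2_inner (weigh F) (weigh (H - P)) = 0"
        using Q(2)[of "weigh F"] F that by (simp add: P weigh_diff N_def)
      then show ?thesis using F H PD by (simp add: S2_inner_S2_fun H2_inner_weigh)
    qed
    then show "S2_fun (H - P) \<in> S2_orth M"
      using H PD by (simp add: S2_orth_def S2_fun_in_S2)
  qed
qed

section \<open>The constant function in a reducing subspace\<close>

text \<open>
  For \<open>F\<close> in the reducing subspace and \<open>G\<close> in its complement, all \<open>\<Psi>\<^sup>k F\<close> and \<open>\<Psi>\<^sup>m G\<close> are orthogonal,
  so \<open>F $ 0 * cnj (G $ 0) = 0\<close>. Hence one of the two subspaces consists of functions vanishing at the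
  origin. These are exactly the functions orthogonal to the constant \<open>1\<close>, so the other subspace
  contains \<open>1\<close>, and with it every power of \<open>\<Psi>\<close>. Any nonzero element of the first one will do.
\<close>
lemma S2_reducible_imp_orthogonal_to_powers:
  assumes iso: "H2_isometric \<Psi>" and mult: "H2_multiplier (fps_deriv \<Psi>)" and q: "cmod (\<Psi> $ 0) < 1"
    and \<psi>: "\<And>z. z \<in> ball 0 1 \<Longrightarrow> \<psi> z = eval_fps \<Psi> z"
    and red: "S2_reducible (mult_op \<psi>)"
  obtains G where "G \<in> S2_fps" "G \<noteq> 0" "\<And>k m. S2_fps_inner (\<Psi> ^ k) (\<Psi> ^ m * G) = 0"
proof -
  note mul = H2_isometric_multiplier[OF iso]
  note D2p [simp] = S2_fps_power_mult[OF mul mult]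
  obtain M where "S2_reducing (mult_op \<psi>) M" and M0: "M \<noteq> {\<lambda>z. 0}" and MS: "M \<noteq> S2"
    using red by (auto simp: S2_reducible_def)
  then have M: "S2_closed_subspace M" and MM: "mult_op \<psi> ` M \<subseteq> M"
    and NN: "mult_op \<psi> ` S2_orth M \<subseteq> S2_orth M"
    by (auto simp: S2_reducing_def)
  have Msub: "M \<subseteq> S2" and M00: "(\<lambda>z. 0) \<in> M" using M by (auto simp: S2_closed_subspace_def)
  have pow: "S2_fun (\<Psi> ^ k * F) \<in> A" if "mult_op \<psi> ` A \<subseteq> A" "F \<in> S2_fps" "S2_fun F \<in> A" for A F k
  proof (induction k)
    case (Suc k)
    have "mult_op \<psi> (S2_fun (\<Psi> ^ k * F)) = S2_fun (\<Psi> * (\<Psi> ^ k * F))"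
      using that by (intro mult_op_S2_fun \<psi> H2_multiplier_in_H2 mul) auto
    then show ?case using Suc that(1) by (auto simp: mult.assoc)
  qed (use that in simp)
  have orth: "S2_fps_inner (\<Psi> ^ k * F) (\<Psi> ^ m * G) = 0"
    if "F \<in> S2_fps" "G \<in> S2_fps" "S2_fun F \<in> M" "S2_fun G \<in> S2_orth M" for F G k m
  proof -
    have "S2_inner (S2_fun (\<Psi> ^ k * F)) (S2_fun (\<Psi> ^ m * G)) = 0"
      using pow[OF MM that(1,3), of k] pow[OF NN that(2,4), of m] by (auto simp: S2_orth_def)
    then show ?thesis using that by (simp add: S2_inner_S2_fun)
  qed
  have zero: "F $ 0 * cnj (G $ 0) = 0"
    if "F \<in> S2_fps" "G \<in> S2_fps" "S2_fun F \<in> M" "S2_fun G \<in> S2_orth M" for F G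
    using that by (intro S2_fps_inner_power_orthogonal(4)[OF iso mult q] orth) auto
  show ?thesis
  proof (cases "\<forall>F\<in>S2_fps. S2_fun F \<in> M \<longrightarrow> F $ 0 = 0")
    case True
    \<comment> \<open>every element of \<open>M\<close> vanishes at the origin\<close>
    have "S2_fun 1 \<in> S2_orth M"
      unfolding S2_orth_def
    proof (intro CollectI conjI ballI)
      fix f assume "f \<in> M"
      then obtain F where F: "F \<in> S2_fps" "f = S2_fun F" using Msub by (meson S2E subsetD)
      then show "S2_inner f (S2_fun 1) = 0"
        using True \<open>f \<in> M\<close> S2_fps_inner_commute[of 1 F] by (simp add: S2_inner_S2_fun S2_fps_inner_1_left)
    qed (simp add: S2_fun_in_S2)
    obtain g where "g \<in> M" "g \<noteq> (\<lambda>z. 0)" using M0 M00 by blast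
    then obtain G where G: "G \<in> S2_fps" "S2_fun G \<in> M" "G \<noteq> 0"
      using Msub by (metis S2E S2_fun_0 subsetD)
    show ?thesis
    proof (rule that)
      show "S2_fps_inner (\<Psi> ^ k) (\<Psi> ^ m * G) = 0" for k m
        using orth[OF G(1) S2_fps_1 G(2) \<open>S2_fun 1 \<in> S2_orth M\<close>, of m k] G D2p[OF S2_fps_1, of k]
          S2_fps_inner_commute[of "\<Psi> ^ m * G" "\<Psi> ^ k"] by simp
    qed (use G in auto)
  next
    case False
    then obtain F where F: "F \<in> S2_fps" "S2_fun F \<in> M" "F $ 0 \<noteq> 0" by blast
    have N0: "G $ 0 = 0" if "G \<in> S2_fps" "S2_fun G \<in> S2_orth M" for G
      using zero[OF F(1) that(1) F(2) that(2)] F(3) by simp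
    \<comment> \<open>every element of the complement vanishes at the origin, in particular the component \<open>R\<close> of
      \<open>1\<close> in it, which is thus orthogonal to \<open>1\<close> and to itself\<close>
    have "S2_fun 1 \<in> M"
    proof -
      obtain P where P: "P \<in> S2_fps" "S2_fun P \<in> M" "S2_fun (1 - P) \<in> S2_orth M"
        using S2_projection[OF M S2_fps_1] .
      define R where "R = 1 - P"
      have R: "R \<in> S2_fps" using P by (simp add: R_def)
      have "S2_fps_inner P R = 0" using orth[of P R 0 0] P R by (simp add: R_def)
      moreover have "S2_fps_inner 1 R = 0" using N0[OF R] P by (simp add: R_def S2_fps_inner_1_left)
      moreover have "S2_fps_inner R R = S2_fps_inner 1 R - S2_fps_inner P R"
        using P R S2_fps_inner_diff_left[of 1 P R] by (simp add: R_def)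
      ultimately have "complex_of_real (H2_norm_sq (weigh R)) = 0"
        using R by (simp add: H2_inner_weigh weigh_in_H2_iff flip: H2_inner_self)
      then have "weigh R = 0" using R by (simp add: H2_norm_sq_eq_0_iff weigh_in_H2_iff)
      then have "R = 0"
        by (metis fps_ext fps_zero_nth mult_eq_0_iff of_nat_eq_0_iff weigh_nth)
      then show ?thesis using P by (simp add: R_def)
    qed
    obtain h where "h \<in> S2" "h \<notin> M" using MS Msub by blast
    then obtain H where H: "H \<in> S2_fps" "S2_fun H \<notin> M" by (metis S2E)
    obtain P where P: "P \<in> S2_fps" "S2_fun P \<in> M" "S2_fun (H - P) \<in> S2_orth M"
      using S2_projection[OF M H(1)] .
    show ?thesis
    proof (rule that)
      show "H - P \<noteq> 0" using H P by auto
      show "S2_fps_inner (\<Psi> ^ k) (\<Psi> ^ m * (H - P)) = 0" for k m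
        using orth[OF S2_fps_1 _ \<open>S2_fun 1 \<in> M\<close> P(3), of k m] H P by simp
    qed (use H P in simp)
  qed
qed

section \<open>The deck transformation fixes the origin\<close>

lemma holomorphic_mult_eq_0:
  assumes f: "f holomorphic_on ball 0 1" and g: "g holomorphic_on ball 0 1"
    and fg: "\<And>z. z \<in> ball 0 1 \<Longrightarrow> f z * g z = 0"
    and z0: "z0 \<in> ball 0 1" "f z0 \<noteq> 0" and z: "z \<in> ball 0 (1::real)"
  shows "g z = (0::complex)"
proof (rule analytic_continuation_open[of "ball 0 1 \<inter> f -` (- {0})" "ball 0 1" g "\<lambda>_. 0"])
  show "open (ball 0 1 \<inter> f -` (- {0}))"
    using f by (intro continuous_open_preimage holomorphic_on_imp_continuous_on) auto
qed (use assms in auto)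

lemma disk_aut_deriv:
  assumes "cmod d < 1" "cmod z < 1"
  shows "(disk_aut d has_field_derivative - (1 - d * cnj d) / (1 - cnj d * z)\<^sup>2) (at z)"
  unfolding disk_aut_def
  using disk_aut_denom_nonzero[OF assms]
  by (auto intro!: derivative_eq_intros simp: power2_eq_square algebra_simps)

lemma disk_aut_second_deriv:
  assumes "cmod d < 1" "cmod z < 1"
  shows "((\<lambda>z. - (1 - d * cnj d) / (1 - cnj d * z)\<^sup>2) has_field_derivative
    - 2 * cnj d * (1 - d * cnj d) / (1 - cnj d * z) ^ 3) (at z)"
proof -
  define q where "q = 1 - cnj d * z"
  have q: "q \<noteq> 0" using disk_aut_denom_nonzero[OF assms] by (simp add: q_def)
  have 1: "((\<lambda>z. (1 - cnj d * z)\<^sup>2) has_field_derivative - 2 * cnj d * q) (at z)"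
    unfolding q_def by (rule derivative_eq_intros refl)+ (simp add: algebra_simps)
  have "((\<lambda>z. - (1 - d * cnj d) / (1 - cnj d * z)\<^sup>2) has_field_derivative
    (0 * q\<^sup>2 - - (1 - d * cnj d) * (- 2 * cnj d * q)) / (q\<^sup>2 * q\<^sup>2)) (at z)"
    unfolding q_def by (rule DERIV_divide[OF DERIV_const 1[unfolded q_def]]) (use q in \<open>simp add: q_def\<close>)
  also have "(0 * q\<^sup>2 - - (1 - d * cnj d) * (- 2 * cnj d * q)) / (q\<^sup>2 * q\<^sup>2)
    = (q * (- 2 * cnj d * (1 - d * cnj d))) / (q * q ^ 3)"
    by (rule arg_cong2[of _ _ _ _ "(/)"]) (simp_all add: algebra_simps eval_nat_numeral)
  also have "\<dots> = - 2 * cnj d * (1 - d * cnj d) / q ^ 3"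
    using q by (rule nonzero_mult_divide_mult_cancel_left)
  finally show ?thesis by (simp add: q_def)
qed

text \<open>
  Let \<open>\<tau>\<close> be the automorphism that exchanges the points of the fibres of \<open>\<psi>\<close>, and let \<open>g\<close> be the function
  with Taylor series \<open>G\<close>. The trace lemma for \<open>G'\<close> and for \<open>\<Psi>' G\<close> gives, after cancelling \<open>\<psi>'\<close> in the
  second case, the functional equations
  \<open>z g'(z) + \<tau>(z) g'(\<tau>(z)) = 0\<close> and \<open>z \<tau>'(z) g(z) + \<tau>(z) g(\<tau>(z)) = 0\<close>.
  Differentiating the second and using the first removes \<open>g'\<close>; eliminating \<open>g(\<tau>(z))\<close> leaves
  \<open>((\<tau>'(z) + z \<tau>''(z)) \<tau>(z) - z \<tau>'(z)\<^sup>2) g(z) = 0\<close>. As \<open>g\<close> is not zero, the first factor vanishes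
  identically, and its value at \<open>0\<close> is \<open>\<tau>'(0) \<tau>(0)\<close> with \<open>\<tau>'(0) \<noteq> 0\<close>.
\<close>
lemma swap_point_eq_0:
  assumes c: "cmod c = 1" and a: "cmod a < 1" and b: "cmod b < 1"
  defines "\<Psi> \<equiv> blaschke2 c a b"
  assumes G: "G \<in> S2_fps" "G \<noteq> 0" and orth: "\<And>k m. S2_fps_inner (\<Psi> ^ k) (\<Psi> ^ m * G) = 0"
  shows "swap_point a b = 0"
proof -
  define d where "d = swap_point a b"
  define \<tau> \<tau>1 \<tau>2 where "\<tau> = disk_aut d" and "\<tau>1 z = - (1 - d * cnj d) / (1 - cnj d * z)\<^sup>2"
    and "\<tau>2 z = - 2 * cnj d * (1 - d * cnj d) / (1 - cnj d * z) ^ 3" for z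
  define g g1 where "g = eval_fps G" and "g1 = eval_fps (fps_deriv G)"
  define p p1 where "p = eval_fps \<Psi>" and "p1 = eval_fps (fps_deriv \<Psi>)"
  have d: "cmod d < 1" unfolding d_def by (rule cmod_swap_point_less_1[OF a b])
  have iso: "H2_isometric \<Psi>" unfolding \<Psi>_def by (rule H2_isometric_blaschke2[OF c a b])
  have mult: "H2_multiplier (fps_deriv \<Psi>)" unfolding \<Psi>_def by (rule H2_multiplier_deriv_blaschke2[OF a b])
  note [simp] = H2_isometric_multiplier[OF iso] mult G(1) H2_multiplier_in_H2
  have p: "p z = c * (disk_aut a z * disk_aut b z)" if "cmod z < 1" for z
    unfolding p_def \<Psi>_def by (rule eval_blaschke2[OF c a b that])
  have tau: "cmod (\<tau> z) < 1" if "cmod z < 1" for z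
    unfolding \<tau>_def by (rule cmod_disk_aut_less_1[OF d that])
  have p_tau: "p (\<tau> z) = p z" if "cmod z < 1" for z
    using blaschke2_swap[OF a b that] p[OF that] p[OF tau[OF that]] by (simp add: \<tau>_def d_def)
  have dtau: "(\<tau> has_field_derivative \<tau>1 z) (at z)" "(\<tau>1 has_field_derivative \<tau>2 z) (at z)" if "cmod z < 1" for z
    using disk_aut_deriv[OF d that] disk_aut_second_deriv[OF d that] by (simp_all add: \<tau>_def \<tau>1_def[abs_def] \<tau>2_def)
  have deriv: "(eval_fps F has_field_derivative eval_fps (fps_deriv F) z) (at z)" if "F \<in> H2" "cmod z < 1" for F z
    using that by (intro has_field_derivative_eval_fps H2_in_conv_radius)
  have dg: "(g has_field_derivative g1 z) (at z)" if "cmod z < 1" for z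
    unfolding g_def g1_def using that by (intro deriv) simp_all
  have dp: "(p has_field_derivative p1 z) (at z)" if "cmod z < 1" for z
    unfolding p_def p1_def using that by (intro deriv) simp_all
  have q: "cmod (\<Psi> $ 0) < 1"
  proof -
    have "\<Psi> $ 0 = p 0" by (simp add: p_def eval_fps_at_0)
    then show ?thesis
      using p[of 0] c a b mult_strict_mono[of "cmod a" 1 "cmod b" 1] by (simp add: disk_aut_def norm_mult)
  qed
  \<comment> \<open>the derivative of \<open>\<psi> \<circ> \<tau> = \<psi>\<close>\<close>
  have chain: "p1 z = p1 (\<tau> z) * \<tau>1 z" if z: "cmod z < 1" for z
  proof (rule DERIV_unique)
    show "(p has_field_derivative p1 z) (at z)" by (rule dp[OF z])
    have "((\<lambda>z. p (\<tau> z)) has_field_derivative p1 (\<tau> z) * \<tau>1 z) (at z)"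
      by (rule DERIV_chain2[OF dp[OF tau[OF z]] dtau(1)[OF z]])
    then show "(p has_field_derivative p1 (\<tau> z) * \<tau>1 z) (at z)"
      by (rule has_field_derivative_transform_within_open[of _ _ _ "ball 0 1"]) (use z p_tau in auto)
  qed
  have hol: "f holomorphic_on ball 0 1" if "\<And>z. cmod z < 1 \<Longrightarrow> (f has_field_derivative f' z) (at z)" for f f' :: "complex \<Rightarrow> complex"
  proof (rule holomorphic_onI)
    fix z :: complex assume "z \<in> ball 0 1"
    then have "(f has_field_derivative f' z) (at z within ball 0 1)"
      by (intro has_field_derivative_at_within[OF that]) simp
    then show "f field_differentiable at z within ball 0 1" by (auto simp: field_differentiable_def)
  qed
  have hol_eval: "eval_fps F holomorphic_on ball 0 1" if "F \<in> H2" for F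
    using that by (rule S2_fun_holomorphic)
  have hol_tau: "\<tau> holomorphic_on ball 0 1" "\<tau>1 holomorphic_on ball 0 1" "\<tau>2 holomorphic_on ball 0 1"
  proof -
    show "\<tau> holomorphic_on ball 0 1" "\<tau>1 holomorphic_on ball 0 1"
      using hol[of \<tau> \<tau>1] hol[of \<tau>1 \<tau>2] dtau by blast+
    show "\<tau>2 holomorphic_on ball 0 1"
      unfolding \<tau>2_def using disk_aut_denom_nonzero[OF d] by (intro holomorphic_intros) auto
  qed
  have hol_g: "g holomorphic_on ball 0 1" "g1 holomorphic_on ball 0 1"
    and hol_p: "p holomorphic_on ball 0 1" "p1 holomorphic_on ball 0 1"
    unfolding g_def g1_def p_def p1_def by (intro hol_eval; simp)+
  have hol_comp: "(\<lambda>z. f (\<tau> z)) holomorphic_on ball 0 1" if "f holomorphic_on ball 0 1" for f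
  proof -
    have "(f \<circ> \<tau>) holomorphic_on ball 0 1"
      by (rule holomorphic_on_compose_gen[OF hol_tau(1) that]) (use tau in auto)
    then show ?thesis by (simp add: o_def)
  qed
  obtain z0 where z0: "cmod z0 < 1" "p z0 \<noteq> 0"
  proof -
    have "\<not> ball (0::complex) 1 \<subseteq> {a, b}"
      using finite_subset[of "ball 0 1" "{a, b}"] uncountable_ball[of 1 "0::complex"] countable_finite by auto
    then obtain z where "z \<in> ball 0 1" "z \<notin> {a, b}" by blast
    then have z: "cmod z < 1" "z \<noteq> a" "z \<noteq> b" by auto
    have "c \<noteq> 0" using c by auto
    then show thesis
      using z that[of z] p[of z] disk_aut_denom_nonzero[OF a z(1)] disk_aut_denom_nonzero[OF b z(1)]
      by (auto simp: disk_aut_def)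
  qed
  note orth' = S2_fps_inner_orthogonal_to_powers[OF iso mult q S2_fps_deriv[OF G(1)] orth]
  have trace: "p z * (z * eval_fps U z + \<tau> z * eval_fps U (\<tau> z)) = 0"
    if "U \<in> H2" "\<And>k. H2_inner (fps_deriv \<Psi> * \<Psi> ^ k) (\<Psi> * U) = 0" "cmod z < 1" for U z
    using blaschke2_trace_eq_zero[OF c a b that(3,1) that(2)[unfolded \<Psi>_def]] p[OF that(3)]
    by (auto simp: \<tau>_def d_def)
  have I: "z * g1 z + \<tau> z * g1 (\<tau> z) = 0" if "cmod z < 1" for z
  proof (rule holomorphic_mult_eq_0[OF hol_p(1), where g = "\<lambda>z. z * g1 z + \<tau> z * g1 (\<tau> z)"])
    show "(\<lambda>z. z * g1 z + \<tau> z * g1 (\<tau> z)) holomorphic_on ball 0 1"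
      by (intro holomorphic_intros hol_g hol_tau hol_comp)
    show "p z * (z * g1 z + \<tau> z * g1 (\<tau> z)) = 0" if "z \<in> ball 0 1" for z
      unfolding g1_def using that by (intro trace orth'(1)) auto
  qed (use z0 that in auto)
  \<comment> \<open>the trace lemma yields only that the product of \<open>h\<close> with \<open>\<psi>' \<circ> \<tau>\<close> vanishes\<close>
  define h where "h z = z * \<tau>1 z * g z + \<tau> z * g (\<tau> z)" for z
  have hol_h: "h holomorphic_on ball 0 1"
    unfolding h_def by (intro holomorphic_intros hol_g hol_tau hol_comp)
  have p1h: "p1 (\<tau> z) * h z = 0" if "cmod z < 1" for z
  proof (rule holomorphic_mult_eq_0[OF hol_p(1), where g = "\<lambda>z. p1 (\<tau> z) * h z"])
    show "(\<lambda>z. p1 (\<tau> z) * h z) holomorphic_on ball 0 1"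
      by (intro holomorphic_intros hol_h hol_comp hol_p)
    show "p z * (p1 (\<tau> z) * h z) = 0" if "z \<in> ball 0 1" for z
    proof -
      from that have z: "cmod z < 1" by simp
      have ev: "eval_fps (fps_deriv \<Psi> * G) x = p1 x * g x" if "cmod x < 1" for x
        unfolding p1_def g_def using that by (intro H2_eval_mult) auto
      have "p z * (z * (p1 z * g z) + \<tau> z * (p1 (\<tau> z) * g (\<tau> z))) = 0"
        unfolding ev[symmetric, OF z] ev[symmetric, OF tau[OF z]]
        using z by (intro trace orth'(2)) auto
      then show ?thesis
        unfolding chain[OF z] h_def by (simp add: algebra_simps)
    qed
  qed (use z0 that in auto)
  \<comment> \<open>otherwise \<open>\<psi>\<close> would be constant on the disk\<close>
  have "\<exists>z. cmod z < 1 \<and> p1 (\<tau> z) \<noteq> 0"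
  proof (rule ccontr)
    assume "\<nexists>z. cmod z < 1 \<and> p1 (\<tau> z) \<noteq> 0"
    then have "\<And>z. cmod z < 1 \<Longrightarrow> p1 z = 0" using chain by auto
    then have "(p has_field_derivative 0) (at z within ball 0 1)" if "z \<in> ball 0 1" for z
      using has_field_derivative_at_within[OF dp[of z]] that by simp
    then obtain k where "\<And>z. z \<in> ball 0 1 \<Longrightarrow> p z = k"
      using has_field_derivative_zero_constant[OF convex_ball, of 0 1 p] by blast
    then have "p z0 = p a" using z0 a by simp
    also have "p a = 0" using p[OF a] by (simp add: disk_aut_def)
    finally show False using z0 by simp
  qed
  then obtain z1 where z1: "cmod z1 < 1" "p1 (\<tau> z1) \<noteq> 0" by blast
  have h0: "h z = 0" if "cmod z < 1" for z
    by (rule holomorphic_mult_eq_0[OF hol_comp[OF hol_p(2)] hol_h]) (use p1h z1 that in auto)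
  define e where "e z = (\<tau>1 z + z * \<tau>2 z) * \<tau> z - z * (\<tau>1 z)\<^sup>2" for z
  have eg: "g z * e z = 0" if z: "cmod z < 1" for z
  proof -
    have "(h has_field_derivative
       (\<tau>1 z + z * \<tau>2 z) * g z + \<tau>1 z * g (\<tau> z) + \<tau>1 z * (z * g1 z + \<tau> z * g1 (\<tau> z))) (at z)"
      unfolding h_def
      by (rule derivative_eq_intros dtau[OF z] dg[OF z] DERIV_chain2[OF dg[OF tau[OF z]] dtau(1)[OF z]] refl)+
        (simp add: algebra_simps)
    moreover have "(h has_field_derivative 0) (at z)"
      by (rule has_field_derivative_transform_within_open[of "\<lambda>_. 0" _ _ "ball 0 1"]) (use z h0 in auto)
    ultimately have "(\<tau>1 z + z * \<tau>2 z) * g z + \<tau>1 z * g (\<tau> z) + \<tau>1 z * (z * g1 z + \<tau> z * g1 (\<tau> z)) = 0"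
      by (rule DERIV_unique)
    then have D: "(\<tau>1 z + z * \<tau>2 z) * g z + \<tau>1 z * g (\<tau> z) = 0" unfolding I[OF z] by simp
    have "g z * e z = \<tau> z * ((\<tau>1 z + z * \<tau>2 z) * g z + \<tau>1 z * g (\<tau> z)) - \<tau>1 z * h z"
      by (simp add: e_def h_def algebra_simps power2_eq_square)
    then show ?thesis unfolding D h0[OF z] by simp
  qed
  have "\<exists>z. cmod z < 1 \<and> g z \<noteq> 0"
  proof (rule ccontr)
    assume "\<nexists>z. cmod z < 1 \<and> g z \<noteq> 0"
    then have "S2_fun G = S2_fun 0" by (auto simp: S2_fun_def g_def)
    then show False using G S2_fun_inject[of G 0] by simp
  qed
  then obtain z2 where z2: "cmod z2 < 1" "g z2 \<noteq> 0" by blast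
  have "e 0 = 0"
  proof (rule holomorphic_mult_eq_0[OF hol_g(1), where g = e])
    show "e holomorphic_on ball 0 1" unfolding e_def by (intro holomorphic_intros hol_tau)
  qed (use z2 eg in auto)
  moreover have "e 0 = - (1 - cnj d * d) * d" by (simp add: e_def \<tau>1_def \<tau>_def disk_aut_def mult.commute)
  ultimately show ?thesis
    using disk_aut_denom_nonzero[OF d d] by (simp add: d_def)
qed

section \<open>Blaschke products with opposite zeros\<close>

text \<open>
  The hypothesis amounts to \<open>a (1 - \<bar>b\<bar>\<^sup>2) = - b (1 - \<bar>a\<bar>\<^sup>2)\<close>. Taking absolute values gives
  \<open>\<bar>a\<bar> = \<bar>b\<bar>\<close>, because \<open>x / (1 - x\<^sup>2)\<close> is injective on \<open>[0, 1)\<close>.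
\<close>
lemma swap_point_eq_0_imp:
  assumes a: "cmod a < 1" and b: "cmod b < 1" and swap: "swap_point a b = 0"
  shows "b = - a"
proof -
  define x y where "x = cmod a" and "y = cmod b"
  have xy: "0 \<le> x" "x < 1" "0 \<le> y" "y < 1" using a b by (auto simp: x_def y_def)
  have "0 = a + b - a * b * (cnj a + cnj b)"
    using swap one_minus_norm_prod_nonzero[OF a b] by (simp add: swap_point_def)
  also have "\<dots> = a * of_real (1 - y\<^sup>2) + b * of_real (1 - x\<^sup>2)"
    unfolding x_def y_def of_real_diff complex_norm_square of_real_1 by (simp add: algebra_simps)
  finally have eq: "b * of_real (1 - x\<^sup>2) = - (a * of_real (1 - y\<^sup>2))"
    by (metis add_eq_0_iff)
  have pos: "1 - x\<^sup>2 > 0" "1 - y\<^sup>2 > 0" using xy by (simp_all add: power_less_one_iff)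
  have "y * (1 - x\<^sup>2) = x * (1 - y\<^sup>2)"
    using arg_cong[OF eq, of cmod] pos unfolding norm_minus_cancel norm_mult norm_of_real x_def[symmetric] y_def[symmetric]
    by simp
  then have "(y - x) * (1 + x * y) = 0" by (simp add: algebra_simps power2_eq_square)
  moreover have "1 + x * y \<noteq> 0" using xy by (smt (verit) mult_nonneg_nonneg)
  ultimately have "x = y" by simp
  then have "(b + a) * of_real (1 - x\<^sup>2) = 0" using eq by (simp only: distrib_right) simp
  moreover have "complex_of_real (1 - x\<^sup>2) \<noteq> 0" using pos by (simp only: of_real_eq_0_iff)
  ultimately have "b + a = 0" by (simp only: mult_eq_0_iff) simp
  then show ?thesis by (simp add: add_eq_0_iff2)
qed

lemma disk_aut_involution:
  assumes a: "cmod a < 1" and z: "cmod z < 1"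
  shows "disk_aut a (disk_aut a z) = z"
proof -
  define q r where "q = 1 - cnj a * z" and "r = 1 - cnj a * a"
  have q: "q \<noteq> 0" and r: "r \<noteq> 0"
    using disk_aut_denom_nonzero[OF a z] disk_aut_denom_nonzero[OF a a] by (simp_all add: q_def r_def)
  have "a - (a - z) / q = (z * r) / q" "1 - cnj a * ((a - z) / q) = r / q"
    using q by (simp_all add: field_simps) (simp_all add: q_def r_def algebra_simps)
  then show ?thesis
    using q r by (simp add: disk_aut_def flip: q_def)
qed

text \<open>
  Here \<open>\<psi> z = - c * \<phi> (z\<^sup>2)\<close> for the involution \<open>\<phi>\<close> of the disk that exchanges \<open>0\<close> and \<open>a\<^sup>2\<close>. So
  \<open>z\<^sup>2 = \<phi> (- cnj c * \<psi> z)\<close>, and the rotation by \<open>- cnj c\<close> can be moved outside \<open>\<phi>\<close> by rotating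
  its parameter.
\<close>
lemma blaschke2_symmetric_equivalent:
  assumes c: "cmod c = 1" and a: "cmod a < 1"
    and \<psi>: "\<And>z. z \<in> ball 0 1 \<Longrightarrow> \<psi> z = c * (disk_aut a z * disk_aut (- a) z)"
  shows "blaschke_equivalent \<psi> (\<lambda>z. z\<^sup>2)"
  unfolding blaschke_equivalent_def
proof (intro exI conjI ballI)
  have a2: "cmod (a\<^sup>2) < 1" using a by (simp add: norm_power power_less_one_iff)
  show "cmod (- cnj c) = 1" using c by simp
  show "- c * a\<^sup>2 \<in> ball 0 1" using c a2 by (simp add: norm_mult)
  fix z :: complex assume z: "z \<in> ball 0 1"
  then have z2: "cmod (z\<^sup>2) < 1" by (simp add: norm_power power_less_one_iff)
  define t where "t = disk_aut (a\<^sup>2) (z\<^sup>2)"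
  have cc: "cnj c * c = 1" using c complex_norm_square[of c] by (simp add: mult.commute)
  have "disk_aut a z * disk_aut (- a) z = - t"
    unfolding t_def disk_aut_def times_divide_times_eq
    by (simp add: algebra_simps power2_eq_square minus_divide_left)
  then have "\<psi> z = - c * t" using \<psi>[OF z] by simp
  then have "- cnj c * disk_aut (- c * a\<^sup>2) (\<psi> z)
      = (cnj c * c * (a\<^sup>2 - t)) / (1 - cnj (a\<^sup>2) * (cnj c * c * t))"
    by (simp add: disk_aut_def algebra_simps)
  also have "\<dots> = disk_aut (a\<^sup>2) t" unfolding cc by (simp add: disk_aut_def)
  also have "\<dots> = z\<^sup>2" unfolding t_def by (rule disk_aut_involution[OF a2 z2])
  finally show "z\<^sup>2 = - cnj c * disk_aut (- c * a\<^sup>2) (\<psi> z)" by simp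
qed

section \<open>The order of a finite Blaschke product\<close>

text \<open>
  The factors with \<open>a k = z\<close> each contribute \<open>w - z\<close>; all others are nonzero at \<open>z\<close>.
\<close>
lemma zorder_blaschke:
  fixes a :: "nat \<Rightarrow> complex"
  assumes c: "cmod c = 1" and a: "\<And>k. k < n \<Longrightarrow> a k \<in> ball 0 1"
    and \<psi>: "\<And>z. z \<in> ball 0 1 \<Longrightarrow> \<psi> z = c * (\<Prod>k<n. disk_aut (a k) z)"
    and z: "z \<in> ball 0 1"
  shows "zorder \<psi> z = int (card {k \<in> {..<n}. a k = z})"
proof -
  define K where "K = {k \<in> {..<n}. a k = z}"
  define g where "g w = c * ((\<Prod>k\<in>K. - 1 / (1 - cnj (a k) * w)) * (\<Prod>k\<in>{..<n} - K. disk_aut (a k) w))" for w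
  have nz: "1 - cnj (a k) * w \<noteq> 0" if "k < n" "w \<in> ball 0 1" for k w
    using a[OF that(1)] that(2) by (intro disk_aut_denom_nonzero) auto
  have "zorder \<psi> z = int (card K)"
  proof (rule zorder_eqI[of "ball 0 1" z g])
    show "g holomorphic_on ball 0 1"
      unfolding g_def disk_aut_def using nz by (intro holomorphic_intros) (auto simp: K_def)
    have "c \<noteq> 0" using c by auto
    moreover have "(\<Prod>k\<in>K. - 1 / (1 - cnj (a k) * z)) \<noteq> 0"
      using nz z by (auto simp: K_def)
    moreover have "(\<Prod>k\<in>{..<n} - K. disk_aut (a k) z) \<noteq> 0"
      using nz z by (auto simp: K_def disk_aut_def)
    ultimately show "g z \<noteq> 0" by (simp add: g_def)
    fix w assume w: "w \<in> ball (0::complex) 1"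
    have "(\<Prod>k<n. disk_aut (a k) w) = (\<Prod>k\<in>{..<n} - K. disk_aut (a k) w) * (\<Prod>k\<in>K. disk_aut (a k) w)"
      by (rule prod.subset_diff) (auto simp: K_def)
    also have "(\<Prod>k\<in>K. disk_aut (a k) w) = (\<Prod>k\<in>K. - 1 / (1 - cnj (a k) * w) * (w - z))"
      by (intro prod.cong) (auto simp: K_def disk_aut_def divide_inverse algebra_simps)
    also have "\<dots> = (\<Prod>k\<in>K. - 1 / (1 - cnj (a k) * w)) * (w - z) ^ card K"
      by (simp only: prod.distrib prod_constant)
    finally show "\<psi> w = g w * (w - z) powi int (card K)"
      using \<psi>[OF w] by (simp add: g_def mult_ac)
  qed (use z in auto)
  then show ?thesis by (simp add: K_def)
qed

lemma blaschke_order_eq: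
  fixes a :: "nat \<Rightarrow> complex"
  assumes c: "cmod c = 1" and a: "\<And>k. k < n \<Longrightarrow> a k \<in> ball 0 1"
    and \<psi>: "\<And>z. z \<in> ball 0 1 \<Longrightarrow> \<psi> z = c * (\<Prod>k<n. disk_aut (a k) z)"
  shows "blaschke_order \<psi> = n"
proof -
  have nz: "1 - cnj (a k) * w \<noteq> 0" if "k < n" "w \<in> ball 0 1" for k w
    using a[OF that(1)] that(2) by (intro disk_aut_denom_nonzero) auto
  have zeros: "{z \<in> ball 0 1. \<psi> z = 0} = a ` {..<n}"
  proof -
    have "\<psi> z = 0 \<longleftrightarrow> z \<in> a ` {..<n}" if "z \<in> ball 0 1" for z
      using \<psi>[OF that] c nz[OF _ that] by (auto simp: disk_aut_def)
    then show ?thesis using a by auto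
  qed
  have "blaschke_order \<psi> = (\<Sum>z\<in>a ` {..<n}. card {k \<in> {..<n}. a k = z})"
    unfolding blaschke_order_def zeros
  proof (intro sum.cong refl)
    fix z assume "z \<in> a ` {..<n}"
    then have "z \<in> ball 0 1" using a by auto
    from zorder_blaschke[OF c a \<psi> this] show "nat (zorder \<psi> z) = card {k \<in> {..<n}. a k = z}" by simp
  qed
  also have "\<dots> = (\<Sum>k<n. 1)"
    using sum.image_gen[of "{..<n}" "\<lambda>_. 1::nat" a] by simp
  finally show ?thesis by simp
qed

section \<open>The subspace of even functions\<close>

text \<open>
  The Taylor series of \<open>z \<mapsto> f (- z)\<close>.
\<close>
definition fps_reflect :: "complex fps \<Rightarrow> complex fps" where
  "fps_reflect F = Abs_fps (\<lambda>n. (-1) ^ n * F $ n)"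

lemma fps_reflect_nth [simp]: "fps_reflect F $ n = (-1) ^ n * F $ n"
  by (simp add: fps_reflect_def)

lemma fps_reflect_mult: "fps_reflect (F * G) = fps_reflect F * fps_reflect G"
proof (rule fps_ext)
  fix n
  have "(-1) ^ n * (\<Sum>i=0..n. F $ i * G $ (n - i)) = (\<Sum>i=0..n. (-1) ^ i * F $ i * ((-1) ^ (n - i) * G $ (n - i)))"
    unfolding sum_distrib_left
  proof (intro sum.cong refl)
    fix i assume "i \<in> {0..n}"
    then have "(-1) ^ n = (-1) ^ i * (-1 :: complex) ^ (n - i)" by (simp flip: power_add)
    then show "(-1) ^ n * (F $ i * G $ (n - i)) = (-1) ^ i * F $ i * ((-1) ^ (n - i) * G $ (n - i))" by simp
  qed
  then show "fps_reflect (F * G) $ n = (fps_reflect F * fps_reflect G) $ n"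
    by (simp add: fps_mult_nth)
qed

lemma fps_reflect_eq_self_iff: "fps_reflect F = F \<longleftrightarrow> (\<forall>n. odd n \<longrightarrow> F $ n = 0)"
proof -
  have "(-1) ^ n * F $ n = F $ n \<longleftrightarrow> (odd n \<longrightarrow> F $ n = 0)" for n
    by (cases "even n") auto
  then show ?thesis by (simp add: fps_eq_iff)
qed

lemma fps_reflect_eq_uminus_iff: "fps_reflect F = - F \<longleftrightarrow> (\<forall>n. even n \<longrightarrow> F $ n = 0)"
proof -
  have "(-1) ^ n * F $ n = - F $ n \<longleftrightarrow> (even n \<longrightarrow> F $ n = 0)" for n
    by (cases "even n") auto
  then show ?thesis by (simp add: fps_eq_iff)
qed

lemma fps_reflect_in_S2_fps [simp]: "F \<in> S2_fps \<Longrightarrow> fps_reflect F \<in> S2_fps"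
  by (simp add: S2_fps_def H2_def norm_mult norm_power del: S2_fps_deriv S2_fps_in_H2)

lemma eval_fps_reflect: "eval_fps (fps_reflect F) z = eval_fps F (- z)"
  by (simp add: eval_fps_def power_minus[of z] mult_ac)

lemma S2_fps_inner_X_power: "F \<in> S2_fps \<Longrightarrow> S2_fps_inner (fps_X ^ n) F = cnj ((if n = 0 then 1 else of_nat n ^ 2) * F $ n)"
proof -
  assume F: "F \<in> S2_fps"
  have "H2_inner (weigh (fps_X ^ n)) (weigh F) = (\<Sum>k\<in>{n}. weigh (fps_X ^ n) $ k * cnj (weigh F $ k))"
    unfolding H2_inner_def by (rule suminf_finite) (auto simp: weigh_nth)
  then show ?thesis
    using F by (simp add: H2_inner_weigh weigh_nth power2_eq_square)
qed

text \<open>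
  Even and odd functions are orthogonal complements of each other, and multiplication by an even
  function preserves both.
\<close>
lemma S2_reducible_even:
  assumes mul: "H2_multiplier \<Psi>" and mul': "H2_multiplier (fps_deriv \<Psi>)"
    and even: "fps_reflect \<Psi> = \<Psi>"
    and \<psi>: "\<And>z. z \<in> ball 0 1 \<Longrightarrow> \<psi> z = eval_fps \<Psi> z"
  shows "S2_reducible (mult_op \<psi>)"
proof -
  define E where "E = {F \<in> S2_fps. fps_reflect F = F}"
  define M where "M = S2_fun ` E"
  have E0: "0 \<in> E" by (simp add: E_def fps_reflect_eq_self_iff)
  have op: "mult_op \<psi> (S2_fun F) = S2_fun (\<Psi> * F)" if "F \<in> S2_fps" for F
    using that by (intro mult_op_S2_fun \<psi> H2_multiplier_in_H2 mul) auto
  have ME: "F \<in> E" if "S2_fun F \<in> M" "F \<in> S2_fps" for F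
    using that S2_fun_inject by (auto simp: M_def E_def)
  have closed: "S2_closed_subspace M"
    unfolding S2_closed_subspace_def
  proof (intro conjI allI ballI impI)
    show "M \<subseteq> S2" by (auto simp: M_def E_def S2_fun_in_S2)
    show "(\<lambda>z. 0) \<in> M" unfolding M_def S2_fun_0[symmetric] using E0 by (rule imageI)
    show "(\<lambda>z. f z + g z) \<in> M" if "f \<in> M" "g \<in> M" for f g
    proof -
      from that obtain F G where FG: "F \<in> E" "f = S2_fun F" "G \<in> E" "g = S2_fun G" by (auto simp: M_def)
      then have "F + G \<in> E" by (simp add: E_def fps_reflect_eq_self_iff)
      moreover have "(\<lambda>z. f z + g z) = S2_fun (F + G)" using FG by (simp add: E_def S2_fun_add)
      ultimately show ?thesis by (simp add: M_def)
    qed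
    show "(\<lambda>z. c * f z) \<in> M" if "f \<in> M" for c f
    proof -
      from that obtain F where F: "F \<in> E" "f = S2_fun F" by (auto simp: M_def)
      then have "fps_const c * F \<in> E" by (simp add: E_def fps_reflect_eq_self_iff)
      moreover have "(\<lambda>z. c * f z) = S2_fun (fps_const c * F)" using F by (simp add: E_def S2_fun_scale)
      ultimately show ?thesis by (simp add: M_def)
    qed
    fix f and F :: "nat \<Rightarrow> complex \<Rightarrow> complex"
    assume f: "f \<in> S2" and "(\<forall>k. F k \<in> M) \<and> (\<lambda>k. S2_norm (\<lambda>z. F k z - f z)) \<longlonglongrightarrow> 0"
    then have "\<forall>k. \<exists>G. G \<in> E \<and> F k = S2_fun G" and lim: "(\<lambda>k. S2_norm (\<lambda>z. F k z - f z)) \<longlonglongrightarrow> 0"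
      by (auto simp: M_def)
    then obtain G where G: "\<And>k. G k \<in> E" "\<And>k. F k = S2_fun (G k)" by metis
    then have GD: "G k \<in> S2_fps" for k by (simp add: E_def)
    obtain L where L: "L \<in> S2_fps" "f = S2_fun L" using f by (rule S2E)
    have "L $ n = 0" if n: "odd n" for n
    proof -
      have "cmod (of_nat n * L $ n) \<le> S2_norm (\<lambda>z. F k z - f z)" for k
      proof -
        have "G k $ n = 0" using G(1)[of k] n by (simp add: E_def fps_reflect_eq_self_iff)
        moreover have "n \<noteq> 0" using n by (intro notI) simp
        ultimately have "cmod (of_nat n * L $ n) = cmod (weigh (G k - L) $ n)"
          by (simp add: weigh_nth norm_mult)
        also have "\<dots> \<le> sqrt (H2_norm_sq (weigh (G k - L)))"
          using L GD by (intro real_le_rsqrt H2_coeff_le) (simp add: weigh_in_H2_iff)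
        also have "\<dots> = S2_norm (\<lambda>z. F k z - f z)"
          using L GD by (simp add: G(2) S2_fun_diff S2_norm_eq_weigh)
        finally show ?thesis .
      qed
      then have "cmod (of_nat n * L $ n) \<le> 0"
        using lim by (intro tendsto_lowerbound[OF lim]) auto
      then show ?thesis using n by auto
    qed
    then show "f \<in> M" using L by (simp add: M_def E_def fps_reflect_eq_self_iff)
  qed
  have orth: "S2_fun G \<in> S2_orth M \<longleftrightarrow> fps_reflect G = - G" if G: "G \<in> S2_fps" for G
  proof
    assume N: "S2_fun G \<in> S2_orth M"
    have "G $ n = 0" if "even n" for n
    proof -
      have "fps_X ^ n \<in> E" using that by (auto simp: E_def fps_reflect_eq_self_iff)
      then have "S2_inner (S2_fun (fps_X ^ n)) (S2_fun G) = 0"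
        using N by (auto simp: S2_orth_def M_def)
      then show ?thesis using G by (auto simp: S2_inner_S2_fun S2_fps_inner_X_power split: if_splits)
    qed
    then show "fps_reflect G = - G" by (simp add: fps_reflect_eq_uminus_iff)
  next
    assume "fps_reflect G = - G"
    then have Gn: "\<And>n. even n \<Longrightarrow> G $ n = 0" by (simp add: fps_reflect_eq_uminus_iff)
    have "S2_inner f (S2_fun G) = 0" if "f \<in> M" for f
    proof -
      from that obtain F where F: "F \<in> E" "f = S2_fun F" by (auto simp: M_def)
      then have Fn: "\<And>n. odd n \<Longrightarrow> F $ n = 0" by (simp add: E_def fps_reflect_eq_self_iff)
      have "weigh F $ n * cnj (weigh G $ n) = 0" for n
        using Fn[of n] Gn[of n] by (cases "even n") (auto simp: weigh_nth)
      then have "H2_inner (weigh F) (weigh G) = 0" by (simp only: H2_inner_def suminf_zero)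
      then show ?thesis using F G by (simp add: S2_inner_S2_fun H2_inner_weigh E_def)
    qed
    then show "S2_fun G \<in> S2_orth M" using G by (simp add: S2_orth_def S2_fun_in_S2)
  qed
  have "S2_reducing (mult_op \<psi>) M"
    unfolding S2_reducing_def
  proof (intro conjI closed)
    show "mult_op \<psi> ` M \<subseteq> M"
    proof
      fix f assume "f \<in> mult_op \<psi> ` M"
      then obtain F where F: "F \<in> E" "f = mult_op \<psi> (S2_fun F)" by (auto simp: M_def)
      then have "\<Psi> * F \<in> E" "f = S2_fun (\<Psi> * F)"
        using S2_fps_mult[OF mul mul'] by (auto simp: E_def fps_reflect_mult even op)
      then show "f \<in> M" by (simp add: M_def)
    qed
    show "mult_op \<psi> ` S2_orth M \<subseteq> S2_orth M"
    proof
      fix f assume "f \<in> mult_op \<psi> ` S2_orth M"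
      then obtain g where g: "g \<in> S2_orth M" "f = mult_op \<psi> g" by blast
      then obtain G where G: "G \<in> S2_fps" "g = S2_fun G" by (auto simp: S2_orth_def elim: S2E)
      then have "fps_reflect (\<Psi> * G) = - (\<Psi> * G)" "\<Psi> * G \<in> S2_fps"
        using g orth[OF G(1)] S2_fps_mult[OF mul mul'] by (auto simp: fps_reflect_mult even)
      then show "f \<in> S2_orth M" using orth[of "\<Psi> * G"] by (simp add: g(2) G(2) op[OF G(1)])
    qed
  qed
  moreover have "M \<noteq> {\<lambda>z. 0}"
  proof
    assume "M = {\<lambda>z. 0}"
    moreover have "S2_fun 1 \<in> M" by (simp add: M_def E_def fps_reflect_eq_self_iff)
    ultimately have "S2_fun 1 = S2_fun 0" by (simp add: S2_fun_0)
    then show False using S2_fun_inject[of 1 0] by simp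
  qed
  moreover have "M \<noteq> S2"
  proof
    assume "M = S2"
    then have "S2_fun (fps_X ^ 1) \<in> M" using S2_fps_X_power by (simp only: S2_fun_in_S2)
    then have "fps_X ^ 1 \<in> E" by (intro ME S2_fps_X_power)
    then have "\<forall>n. odd n \<longrightarrow> (fps_X ^ 1 :: complex fps) $ n = 0"
      unfolding E_def fps_reflect_eq_self_iff by blast
    from this[THEN spec, of 1] show False by simp
  qed
  ultimately show ?thesis unfolding S2_reducible_def by blast
qed

section \<open>Reducibility\<close>

text \<open>
  A function \<open>\<psi>\<close> equivalent to \<open>z\<^sup>2\<close> is even, because \<open>\<phi>\<^sub>\<alpha>\<close> is injective on the disk.
\<close>
theorem theorem4p4:
  fixes \<psi> :: "complex \<Rightarrow> complex"
  assumes "finite_blaschke \<psi>" and "blaschke_order \<psi> = 2"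
  shows "S2_reducible (mult_op \<psi>) \<longleftrightarrow> blaschke_equivalent \<psi> (\<lambda>z. z\<^sup>2)"
proof -
  obtain c and n :: nat and a :: "nat \<Rightarrow> complex" where c: "cmod c = 1" and a: "\<forall>k<n. a k \<in> ball 0 1"
    and prod: "\<forall>z\<in>ball 0 1. \<psi> z = c * (\<Prod>k<n. disk_aut (a k) z)"
    using assms(1) unfolding finite_blaschke_def by blast
  then have n: "n = 2"
    using blaschke_order_eq[of c n a \<psi>] assms(2) by auto
  define x y where "x = a 0" and "y = a 1"
  have x: "cmod x < 1" and y: "cmod y < 1"
    using a n by (auto simp: x_def y_def)
  have \<psi>: "\<psi> z = c * (disk_aut x z * disk_aut y z)" if "z \<in> ball 0 1" for z
    using prod that by (simp add: n x_def y_def numeral_2_eq_2)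
  define \<Psi> where "\<Psi> = blaschke2 c x y"
  have iso: "H2_isometric \<Psi>" and mul': "H2_multiplier (fps_deriv \<Psi>)"
    unfolding \<Psi>_def by (rule H2_isometric_blaschke2[OF c x y], rule H2_multiplier_deriv_blaschke2[OF x y])
  note mul = H2_isometric_multiplier[OF iso]
  have \<psi>\<Psi>: "\<psi> z = eval_fps \<Psi> z" if "z \<in> ball 0 1" for z
    using that \<psi>[OF that] by (simp add: \<Psi>_def eval_blaschke2[OF c x y])
  have lt1: "cmod (\<psi> z) < 1" if "z \<in> ball 0 1" for z
    using c \<psi>[OF that] that
      mult_strict_mono[OF cmod_disk_aut_less_1[OF x, of z] cmod_disk_aut_less_1[OF y, of z]]
    by (simp add: norm_mult)
  show ?thesis
  proof
    assume red: "S2_reducible (mult_op \<psi>)"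
    have "cmod (\<Psi> $ 0) < 1"
      using lt1[of 0] \<psi>\<Psi>[of 0] by (simp add: eval_fps_at_0)
    from S2_reducible_imp_orthogonal_to_powers[OF iso mul' this \<psi>\<Psi> red]
    obtain G where "G \<in> S2_fps" "G \<noteq> 0" "\<And>k m. S2_fps_inner (\<Psi> ^ k) (\<Psi> ^ m * G) = 0" by metis
    then have "swap_point x y = 0"
      unfolding \<Psi>_def by (rule swap_point_eq_0[OF c x y])
    then have "y = - x" by (rule swap_point_eq_0_imp[OF x y])
    then show "blaschke_equivalent \<psi> (\<lambda>z. z\<^sup>2)"
      using \<psi> by (intro blaschke2_symmetric_equivalent[OF c x]) simp
  next
    assume "blaschke_equivalent \<psi> (\<lambda>z. z\<^sup>2)"
    then obtain u \<alpha> where u: "cmod u = 1" and \<alpha>: "cmod \<alpha> < 1"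
      and eq: "\<And>z. z \<in> ball 0 1 \<Longrightarrow> z\<^sup>2 = u * disk_aut \<alpha> (\<psi> z)"
      unfolding blaschke_equivalent_def by auto
    have "\<psi> (- z) = \<psi> z" if "z \<in> ball 0 1" for z
    proof -
      have z': "- z \<in> ball 0 1" using that by simp
      have "u * disk_aut \<alpha> (\<psi> (- z)) = u * disk_aut \<alpha> (\<psi> z)"
        unfolding eq[OF that, symmetric] eq[OF z', symmetric] by simp
      then have "disk_aut \<alpha> (\<psi> (- z)) = disk_aut \<alpha> (\<psi> z)" using u by auto
      then show ?thesis
        using disk_aut_involution[OF \<alpha> lt1[OF that]] disk_aut_involution[OF \<alpha> lt1[OF z']] by simp
    qed
    then have "S2_fun (fps_reflect \<Psi>) = S2_fun \<Psi>"
      by (auto simp: S2_fun_def eval_fps_reflect simp flip: \<psi>\<Psi>)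
    moreover have "\<Psi> \<in> S2_fps" using S2_fps_mult[OF mul mul' S2_fps_1] by simp
    ultimately have "fps_reflect \<Psi> = \<Psi>" by (simp add: S2_fun_inject)
    then show "S2_reducible (mult_op \<psi>)" by (rule S2_reducible_even[OF mul mul' _ \<psi>\<Psi>])
  qed
qed

end
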